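(* Let $\Gamma\Subset U\Subset\Omega^\circ$ with $\Omega\subset\mathbb R^d$ compact and $U$ open. Let $\lambda\in\mathcal P_2(\mathfrak C_\Omega)$, set $\mu:=\mathfrak P\lambda$ with $\mu\in\mathfrak M_+^\Gamma(\Omega)$, and suppose $\lambda$ is radially supported in $[r_{\min},r_{\max}]$ for some $0<r_{\min}\le r_{\max}<\infty$. Then the lifting operator $$\mathcal L_{\mu,\lambda}:T_\mu\mathfrak M_+^\Gamma\to S_\lambda\subset T_\lambda\mathcal P_2(\mathfrak C_\Omega),\qquad \mathcal L_{\mu,\lambda}(v,\beta)(x,r)=(v(x),2\beta(x)r),$$ is an isometry, where $T_\mu\mathfrak M_+^\Gamma$ carries the Hellinger–Kantorovich metric tensor and $S_\lambda:=\mathcal L_{\mu,\lambda}(T_\mu\mathfrak M_+^\Gamma)$ carries the metric tensor of $T_\lambda\mathcal P_2(\mathfrak C_\Omega)$. Suppose in addition that the conditional radial law of $\lambda$ given $x$ is deterministic and supported in $(0,\infty)$; equivalently, there are a Borel measure $\eta$ on $\Omega$ and a measurable map $r:\Omega\to(0,\infty)$ with $\lambda=(x\mapsto(x,r(x)))_\#\eta$. Then for every $u=a+b\,\partial_r\in L^2(\lambda;T\mathfrak C_\Omega)$ the projection operator satisfies $$\mathcal P_\lambda[u](x)=\left(a(x,r(x)),\frac{b(x,r(x))}{2r(x)}\right)\quad\text{for }\mu\text{-a.e. }x.$$ Moreover $\mathcal P_\lambda$ is the isometric inverse of $\mathcal L_{\mu,\lambda}$: $\mathcal P_\lambda\circ\mathcal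 L_{\mu,\lambda}=\mathrm{Id}$ on $T_\mu\mathfrak M_+^\Gamma$, and $\mathcal L_{\mu,\lambda}\circ\mathcal P_\lambda|_{S_\lambda}=\mathrm{Id}$ $\lambda$-a.e.
   Context: $\mathfrak M_+^\Gamma(\Omega)$: finite nonnegative Radon measures on $\Omega$ supported in $\Gamma$. HK tangent space: $T_\mu\mathfrak M_+^\Gamma=\overline{\{(\nabla\varphi,\varphi):\varphi\in C_c^\infty(U)\}}^{L^2(\mu)\times L^2(\mu)}$ with metric tensor $\langle(v_1,\beta_1),(v_2,\beta_2)\rangle_\mu=\int\langle v_1,v_2\rangle+4\beta_1\beta_2\,d\mu$. Cone: $\mathfrak C_\Omega=(\Omega\times[0,\infty))/(\Omega\times\{0\})$, points $(x,r)$. For $r>0$ tangent vectors are $(a,b)=a+b\partial_r$, $a\in\mathbb R^d$, $b\in\mathbb R$, with $\langle(a,b),(a',b')\rangle_{\mathfrak C}=r^2\langle a,a'\rangle+bb'$, and the cone gradient is $\nabla_{\mathfrak C}\Phi=(r^{-2}\nabla_x\Phi,\partial_r\Phi)$. $\mathcal P_2(\mathfrak C_\Omega)$ denotes finite nonnegative Radon measures on $\mathfrak C_\Omega$ (not necessarily of mass one) with $\int r^2d\lambda<\infty$. For $\lambda$ supported away from the apex (the point $r=0$), $T_\lambda\mathcal P_2(\mathfrak C_\Omega)$ is the closure in $L^2(\lambda;T\mathfrak C_\Omega)$ of $\{\nabla_{\mathfrak C}\Phi:\Phi\in C_c^\infty(\Omega^\circ\times(0,\infty))\}$, with metric tensor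 $\int\langle\cdot,\cdot\rangle_{\mathfrak C}\,d\lambda$. "Radially supported in $[r_{\min},r_{\max}]$" means $\operatorname{supp}\lambda\subset\{(x,r):r\in[r_{\min},r_{\max}]\}$. Projection of measures: $\mathfrak P\lambda$ is the measure on $\Omega$ with $\int_\Omega\phi\,d\mathfrak P\lambda=\int_{\mathfrak C_\Omega}r^2\phi(x)\,d\lambda(x,r)$ for all $\phi\in C^0(\Omega)$. Tangent projection: for $u=a+b\partial_r$, $\mathcal P_\lambda[u](x)=\left(\frac{\int_0^\infty r^2a(x,r)\,d\lambda(r|x)}{\int_0^\infty r^2\,d\lambda(r|x)},\ \frac{\int_0^\infty r\,b(x,r)\,d\lambda(r|x)}{2\int_0^\infty r^2\,d\lambda(r|x)}\right)$, where $\lambda(r|x)$ is the conditional law of $r$ given $x$ under $\lambda$. *)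

theory Defs
  imports "HOL-Probability.Probability"
begin

section \<open>Supports, compact containment, test functions\<close>

definition compactly_inside :: "'a::topological_space set \<Rightarrow> 'a set \<Rightarrow> bool" where
  "compactly_inside A B \<longleftrightarrow> compact (closure A) \<and> closure A \<subseteq> B"

definition measure_supp :: "'a topology \<Rightarrow> 'a measure \<Rightarrow> 'a set" where
  "measure_supp X M = {x \<in> topspace X. \<forall>V. openin X V \<and> x \<in> V \<longrightarrow> emeasure M V > 0}"

text \<open>\<open>Ck_fun k f\<close>: \<open>f\<close> is of class \<open>C\<^sup>k\<close> on the whole space.\<close>

fun Ck_fun :: "nat \<Rightarrow> ('a::euclidean_space \<Rightarrow> real) \<Rightarrow> bool" where
  "Ck_fun 0 f \<longleftrightarrow> continuous_on UNIV f"
| "Ck_fun (Suc k) f \<longleftrightarrow>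
     (\<forall>x. f differentiable (at x)) \<and> (\<forall>h. Ck_fun k (\<lambda>x. frechet_derivative f (at x) h))"

text \<open>The space \<open>C\<^sub>c\<^sup>\<infinity>(W)\<close> for \<open>W\<close> open; its elements are identified with their extensions by zero
  to the whole space.\<close>

definition test_functions :: "'a::euclidean_space set \<Rightarrow> ('a \<Rightarrow> real) set" where
  "test_functions W = {f. (\<forall>k. Ck_fun k f) \<and> compactly_inside {x. f x \<noteq> 0} W}"

definition gradient :: "('a::euclidean_space \<Rightarrow> real) \<Rightarrow> 'a \<Rightarrow> 'a" where
  "gradient f x = (THE D. GDERIV f x :> D)"


section \<open>The cone\<close>

text \<open>Points of \<open>(\<Omega> \<times> [0,\<infinity>)) / (\<Omega> \<times> {0})\<close>: the apex is the class \<open>\<Omega> \<times> {0}\<close>, and \<open>CPt x r\<close> with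
  \<open>r > 0\<close> is the singleton class of \<open>(x, r)\<close>.  Terms \<open>CPt x r\<close> with \<open>r \<le> 0\<close> are junk and lie in
  no \<open>cone_over \<Omega>\<close>.\<close>

datatype 'a cone_point = Apex | CPt (cone_base: 'a) (cone_rad: real)
  where "cone_rad Apex = 0"

definition cone_class :: "'a \<times> real \<Rightarrow> 'a cone_point" where
  "cone_class z = (if snd z = 0 then Apex else CPt (fst z) (snd z))"

definition cone_over :: "'a set \<Rightarrow> 'a cone_point set" where
  "cone_over \<Omega> = cone_class ` (\<Omega> \<times> {0..})"

definition cone_topology :: "'a::topological_space set \<Rightarrow> 'a cone_point topology" where
  "cone_topology \<Omega> = topology (\<lambda>V. V \<subseteq> cone_over \<Omega> \<and>
     openin (top_of_set (\<Omega> \<times> {0..})) {z \<in> \<Omega> \<times> {0..}. cone_class z \<in> V})"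

lemma openin_cone_topology:
  "openin (cone_topology \<Omega>) V \<longleftrightarrow> V \<subseteq> cone_over \<Omega> \<and>
     openin (top_of_set (\<Omega> \<times> {0..})) {z \<in> \<Omega> \<times> {0..}. cone_class z \<in> V}"
proof -
  let ?L = "\<lambda>V. V \<subseteq> cone_over \<Omega> \<and>
     openin (top_of_set (\<Omega> \<times> {0..})) {z \<in> \<Omega> \<times> {0..}. cone_class z \<in> V}"
  have "istopology ?L"
    unfolding istopology_def
  proof (intro conjI allI impI)
    fix S T assume S: "?L S" and T: "?L T"
    show "S \<inter> T \<subseteq> cone_over \<Omega>" using S by blast
    have "{z \<in> \<Omega> \<times> {0..}. cone_class z \<in> S \<inter> T}
        = {z \<in> \<Omega> \<times> {0..}. cone_class z \<in> S} \<inter> {z \<in> \<Omega> \<times> {0..}. cone_class z \<in> T}" by blast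
    then show "openin (top_of_set (\<Omega> \<times> {0..})) {z \<in> \<Omega> \<times> {0..}. cone_class z \<in> S \<inter> T}"
      using S T by (simp only: openin_Int)
  next
    fix K assume K: "\<forall>S\<in>K. ?L S"
    show "\<Union>K \<subseteq> cone_over \<Omega>" using K by blast
    have "{z \<in> \<Omega> \<times> {0..}. cone_class z \<in> \<Union>K}
        = (\<Union>S\<in>K. {z \<in> \<Omega> \<times> {0..}. cone_class z \<in> S})" by blast
    moreover have "openin (top_of_set (\<Omega> \<times> {0..})) (\<Union>S\<in>K. {z \<in> \<Omega> \<times> {0..}. cone_class z \<in> S})"
      using K by (intro openin_Union) blast
    ultimately show "openin (top_of_set (\<Omega> \<times> {0..})) {z \<in> \<Omega> \<times> {0..}. cone_class z \<in> \<Union>K}"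
      by simp
  qed
  then show ?thesis unfolding cone_topology_def by (simp add: topology_inverse')
qed

lemma quotient_map_cone_class:
  "quotient_map (top_of_set (\<Omega> \<times> {0..})) (cone_topology \<Omega>) cone_class"
proof -
  have "{z \<in> \<Omega> \<times> {0..}. cone_class z \<in> cone_over \<Omega>} = \<Omega> \<times> {0..}"
    by (auto simp: cone_over_def)
  then have "openin (cone_topology \<Omega>) (cone_over \<Omega>)"
    by (simp add: openin_cone_topology)
  then have "topspace (cone_topology \<Omega>) = cone_over \<Omega>"
    by (metis openin_cone_topology openin_subset openin_topspace subset_antisym)
  then show ?thesis
    unfolding quotient_map_def
    by (simp add: openin_cone_topology) (simp add: cone_over_def)
qed

definition cone_borel :: "'a::topological_space set \<Rightarrow> 'a cone_point measure" where
  "cone_borel \<Omega> = sigma (cone_over \<Omega>) {V. openin (cone_topology \<Omega>) V}"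


section \<open>Measures on the base and on the cone\<close>

text \<open>For compact \<open>\<Omega>\<close> both \<open>\<Omega>\<close> and the cone are \<open>\<sigma>\<close>-compact and metrizable, so finite Radon
  measures are the same as finite Borel measures.\<close>

definition base_borel :: "'a::topological_space set \<Rightarrow> 'a measure" where
  "base_borel \<Omega> = restrict_space borel \<Omega>"

definition base_measures :: "'a::topological_space set \<Rightarrow> 'a set \<Rightarrow> 'a measure set" where
  "base_measures \<Omega> \<Gamma> = {\<mu>. sets \<mu> = sets (base_borel \<Omega>) \<and> finite_measure \<mu> \<and>
     measure_supp (top_of_set \<Omega>) \<mu> \<subseteq> \<Gamma>}"

definition cone_measures :: "'a::topological_space set \<Rightarrow> 'a cone_point measure set" where
  "cone_measures \<Omega> = {\<Lambda>. sets \<Lambda> = sets (cone_borel \<Omega>) \<and> finite_measure \<Lambda> \<and>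
     integrable \<Lambda> (\<lambda>p. (cone_rad p)\<^sup>2)}"

definition radially_supported ::
  "'a::topological_space set \<Rightarrow> real \<Rightarrow> real \<Rightarrow> 'a cone_point measure \<Rightarrow> bool" where
  "radially_supported \<Omega> rmin rmax \<Lambda> \<longleftrightarrow>
     measure_supp (cone_topology \<Omega>) \<Lambda> \<subseteq> {p \<in> cone_over \<Omega>. cone_rad p \<in> {rmin..rmax}}"

text \<open>The integrand \<open>r\<^sup>2 \<phi>(x)\<close> vanishes at the apex because \<open>cone_rad Apex = 0\<close>.\<close>

definition measure_projection ::
  "'a::topological_space set \<Rightarrow> 'a cone_point measure \<Rightarrow> 'a measure" where
  "measure_projection \<Omega> \<Lambda> = (THE \<mu>. sets \<mu> = sets (base_borel \<Omega>) \<and> finite_measure \<mu> \<and>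
     (\<forall>\<phi>::'a \<Rightarrow> real. continuous_on \<Omega> \<phi> \<longrightarrow>
        (\<integral>x. \<phi> x \<partial>\<mu>) = (\<integral>p. (cone_rad p)\<^sup>2 * \<phi> (cone_base p) \<partial>\<Lambda>)))"


section \<open>Tangent spaces\<close>

text \<open>Elements of \<open>L\<^sup>2\<close> spaces are square-integrable Borel representatives; equality of elements is
  equality almost everywhere.  A pair \<open>(v, \<beta>)\<close> is one field with values in \<open>'a \<times> real\<close>.\<close>

definition HK_inner ::
  "'a::euclidean_space measure \<Rightarrow> ('a \<Rightarrow> 'a \<times> real) \<Rightarrow> ('a \<Rightarrow> 'a \<times> real) \<Rightarrow> real" where
  "HK_inner \<mu> w w' = (\<integral>x. fst (w x) \<bullet> fst (w' x) + 4 * snd (w x) * snd (w' x) \<partial>\<mu>)"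

definition HK_tangent :: "'a set \<Rightarrow> 'a measure \<Rightarrow> ('a::euclidean_space \<Rightarrow> 'a \<times> real) set" where
  "HK_tangent U \<mu> = {w \<in> borel_measurable \<mu>. integrable \<mu> (\<lambda>x. (norm (w x))\<^sup>2) \<and>
     (\<forall>\<epsilon>>0. \<exists>\<phi>\<in>test_functions U. (\<integral>x. (norm (w x - (gradient \<phi> x, \<phi> x)))\<^sup>2 \<partial>\<mu>) < \<epsilon>)}"

text \<open>The value at the apex, where there is no tangent space, is a dummy.\<close>

fun cone_metric :: "'a::euclidean_space cone_point \<Rightarrow> 'a \<times> real \<Rightarrow> 'a \<times> real \<Rightarrow> real" where
  "cone_metric Apex c c' = 0"
| "cone_metric (CPt x r) c c' = r\<^sup>2 * (fst c \<bullet> fst c') + snd c * snd c'"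

fun cone_gradient :: "('a::euclidean_space \<times> real \<Rightarrow> real) \<Rightarrow> 'a cone_point \<Rightarrow> 'a \<times> real" where
  "cone_gradient \<Phi> Apex = 0"
| "cone_gradient \<Phi> (CPt x r) =
     ((1 / r\<^sup>2) *\<^sub>R gradient (\<lambda>y. \<Phi> (y, r)) x, deriv (\<lambda>s. \<Phi> (x, s)) r)"

definition cone_inner :: "'a::euclidean_space cone_point measure \<Rightarrow>
    ('a cone_point \<Rightarrow> 'a \<times> real) \<Rightarrow> ('a cone_point \<Rightarrow> 'a \<times> real) \<Rightarrow> real" where
  "cone_inner \<Lambda> u u' = (\<integral>p. cone_metric p (u p) (u' p) \<partial>\<Lambda>)"

definition cone_L2 :: "'a::euclidean_space cone_point measure \<Rightarrow> ('a cone_point \<Rightarrow> 'a \<times> real) set" where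
  "cone_L2 \<Lambda> = {u \<in> borel_measurable \<Lambda>. integrable \<Lambda> (\<lambda>p. cone_metric p (u p) (u p))}"

definition cone_tangent :: "'a set \<Rightarrow> 'a::euclidean_space cone_point measure \<Rightarrow>
    ('a cone_point \<Rightarrow> 'a \<times> real) set" where
  "cone_tangent \<Omega> \<Lambda> = {u \<in> cone_L2 \<Lambda>. \<forall>\<epsilon>>0. \<exists>\<Phi>\<in>test_functions (interior \<Omega> \<times> {0<..}).
     (\<integral>p. cone_metric p (u p - cone_gradient \<Phi> p) (u p - cone_gradient \<Phi> p) \<partial>\<Lambda>) < \<epsilon>}"

fun lift_field :: "('a::euclidean_space \<Rightarrow> 'a \<times> real) \<Rightarrow> 'a cone_point \<Rightarrow> 'a \<times> real" where
  "lift_field w Apex = 0"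
| "lift_field w (CPt x r) = (fst (w x), 2 * snd (w x) * r)"

text \<open>The image of the lifting, closed under almost-everywhere equality.\<close>

definition lift_range :: "'a set \<Rightarrow> 'a measure \<Rightarrow> 'a::euclidean_space cone_point measure \<Rightarrow>
    ('a cone_point \<Rightarrow> 'a \<times> real) set" where
  "lift_range U \<mu> \<Lambda> = {u \<in> borel_measurable \<Lambda>. \<exists>w\<in>HK_tangent U \<mu>. AE p in \<Lambda>. u p = lift_field w p}"

text \<open>\<open>F\<close> induces, on almost-everywhere classes, a linear isometry from \<open>T\<close> (classes modulo
  \<open>M\<close>-null sets, inner product \<open>g\<close>) onto \<open>S\<close> (classes modulo \<open>N\<close>-null sets, inner product \<open>h\<close>).\<close>

definition ae_isometry ::
  "'x measure \<Rightarrow> ('x \<Rightarrow> 'v::real_vector) set \<Rightarrow> (('x \<Rightarrow> 'v) \<Rightarrow> ('x \<Rightarrow> 'v) \<Rightarrow> real) \<Rightarrow>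
   'y measure \<Rightarrow> ('y \<Rightarrow> 'w::real_vector) set \<Rightarrow> (('y \<Rightarrow> 'w) \<Rightarrow> ('y \<Rightarrow> 'w) \<Rightarrow> real) \<Rightarrow>
   (('x \<Rightarrow> 'v) \<Rightarrow> 'y \<Rightarrow> 'w) \<Rightarrow> bool" where
  "ae_isometry M T g N S h F \<longleftrightarrow>
     (\<forall>w\<in>T. F w \<in> S) \<and>
     (\<forall>w\<in>T. \<forall>w'\<in>T. (AE y in N. F w y = F w' y) \<longleftrightarrow> (AE x in M. w x = w' x)) \<and>
     (\<forall>u\<in>S. \<exists>w\<in>T. AE y in N. F w y = u y) \<and>
     (\<forall>w\<in>T. \<forall>w'\<in>T. \<forall>c. AE y in N. F (\<lambda>x. w x + c *\<^sub>R w' x) y = F w y + c *\<^sub>R F w' y) \<and>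
     (\<forall>w\<in>T. \<forall>w'\<in>T. h (F w) (F w') = g w w')"


section \<open>Conditional radial laws and the tangent projection\<close>

definition base_marginal ::
  "'a::topological_space set \<Rightarrow> 'a cone_point measure \<Rightarrow> 'a measure" where
  "base_marginal \<Omega> \<Lambda> =
     distr (restrict_space \<Lambda> (cone_over \<Omega> - {Apex})) (base_borel \<Omega>) cone_base"

text \<open>\<open>\<kappa>\<close> is a version of \<open>x \<mapsto> \<lambda>(\<sqdot>|x)\<close>: a probability kernel disintegrating \<open>\<lambda>\<close> (outside the
  apex, which has no base point) over its \<open>x\<close>-marginal.  It is unique up to null sets of that
  marginal.\<close>

definition conditional_radial_law ::
  "'a::topological_space set \<Rightarrow> 'a cone_point measure \<Rightarrow> ('a \<Rightarrow> real measure) \<Rightarrow> bool" where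
  "conditional_radial_law \<Omega> \<Lambda> \<kappa> \<longleftrightarrow>
     \<kappa> \<in> base_borel \<Omega> \<rightarrow>\<^sub>M prob_algebra borel \<and>
     (\<forall>B\<in>sets \<Lambda>. Apex \<notin> B \<longrightarrow>
        emeasure \<Lambda> B = (\<integral>\<^sup>+x. emeasure (\<kappa> x) {r. 0 < r \<and> CPt x r \<in> B} \<partial>base_marginal \<Omega> \<Lambda>))"

definition deterministic_radial_law ::
  "'a::topological_space set \<Rightarrow> 'a cone_point measure \<Rightarrow> bool" where
  "deterministic_radial_law \<Omega> \<Lambda> \<longleftrightarrow> (\<exists>\<kappa>. conditional_radial_law \<Omega> \<Lambda> \<kappa> \<and>
     (AE x in base_marginal \<Omega> \<Lambda>. \<exists>s>0. \<kappa> x = return borel s))"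

definition graph_measure :: "'a::topological_space set \<Rightarrow> 'a cone_point measure \<Rightarrow>
    'a measure \<Rightarrow> ('a \<Rightarrow> real) \<Rightarrow> bool" where
  "graph_measure \<Omega> \<Lambda> \<eta> \<rho> \<longleftrightarrow>
     sets \<eta> = sets (base_borel \<Omega>) \<and> \<rho> \<in> borel_measurable (base_borel \<Omega>) \<and> (\<forall>x\<in>\<Omega>. 0 < \<rho> x) \<and>
     \<Lambda> = distr \<eta> (cone_borel \<Omega>) (\<lambda>x. CPt x (\<rho> x))"

text \<open>Integration is over \<open>(0,\<infinity>)\<close>: fields live there, and both integrands carry a factor \<open>r\<close>.\<close>

definition tangent_projection ::
  "('a \<Rightarrow> real measure) \<Rightarrow> ('a::euclidean_space cone_point \<Rightarrow> 'a \<times> real) \<Rightarrow> 'a \<Rightarrow> 'a \<times> real" where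
  "tangent_projection \<kappa> u x =
     ((1 / (LINT r:{0<..}|\<kappa> x. r\<^sup>2)) *\<^sub>R (LINT r:{0<..}|\<kappa> x. r\<^sup>2 *\<^sub>R fst (u (CPt x r))),
      (LINT r:{0<..}|\<kappa> x. r * snd (u (CPt x r))) / (2 * (LINT r:{0<..}|\<kappa> x. r\<^sup>2)))"

end

theory Submission
  imports Defs
begin

text \<open>
  Since \<open>\<Lambda>\<close> lives on radii in \<open>[rmin, rmax]\<close>, its projection is the image under \<open>(x, r) \<mapsto> x\<close> of
  \<open>r\<^sup>2 \<Lambda>\<close>.  The weight \<open>r\<^sup>2\<close> is exactly the factor by which the cone metric of \<open>(v, 2\<beta>r)\<close> exceeds
  the Hellinger--Kantorovich tensor of \<open>(v, \<beta>)\<close>, so the lifting is an isometry.  It maps into the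
  tangent space of the cone because the field \<open>(\<nabla>\<phi>, 2\<phi>r)\<close> is the cone gradient of \<open>r\<^sup>2 \<phi>(x)\<close>.
  If \<open>\<Lambda>\<close> is carried by a graph \<open>r = \<rho>(x)\<close>, every conditional radial law is almost surely the Dirac
  mass at \<open>\<rho>(x)\<close>; the tangent projection is then evaluation on the graph, which inverts the lifting.
\<close>

section \<open>Smooth functions\<close>

text \<open>The potential \<open>r^2 * phi(x)\<close> is not compactly supported in
  \<open>(0, infinity)\<close>, so it is no test function on the cone. The bounds on the radii leave
  room for a cutoff: \<open>rmin > 0\<close> keeps it off the apex, and \<open>rmax\<close> lets it
  end. Since \<open>Ck_fun\<close> is recursive, the cutoff is built from \<open>exp (-1/x)\<close>
  by operations shown to preserve the class.

  The second difficulty is the transfer of null sets. The density \<open>r^2\<close> is bounded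
  below by \<open>rmin^2\<close>, so \<open>\<Lambda>\<close> and its weighted version have the same
  null sets; statements about the base move between the marginal of \<open>\<Lambda>\<close> and
  \<open>\<mu>\<close> through this fact.

  Two objects are given only indirectly. The projected measure is a definite description, so finite
  measures must be shown to be determined by integrals of continuous functions. The conditional law
  is an arbitrary version; it is identified by testing the disintegration on the graph itself.

  The factors 4 in the estimates compare two norms: the closure defining \<open>HK_tangent\<close>
  uses \<open>|v|^2 + beta^2\<close>, the tensor uses \<open>|v|^2 + 4 beta^2\<close>.\<close>

lemma Ck_fun_SucI:
  assumes "\<And>x. (f has_derivative f' x) (at x)" and "\<And>h. Ck_fun k (\<lambda>x. f' x h)"
  shows "Ck_fun (Suc k) f"
proof -
  have "frechet_derivative f (at x) = f' x" for x
    using assms(1) frechet_derivative_at by metis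
  then show ?thesis
    using assms by (auto simp: differentiable_def)
qed

lemma Ck_fun_has_derivative:
  "Ck_fun (Suc k) f \<Longrightarrow> (f has_derivative frechet_derivative f (at x)) (at x)"
  by (simp add: frechet_derivative_works)

lemma Ck_fun_continuous: "Ck_fun k f \<Longrightarrow> continuous_on UNIV f"
  by (cases k) (auto intro!: differentiable_imp_continuous_on simp: differentiable_on_def
      differentiable_at_withinI)

text \<open>Product and chain rules leave undifferentiated factors behind, whose order must drop by
  one before the induction hypothesis applies.\<close>

lemma Ck_fun_Suc_imp: "Ck_fun (Suc k) f \<Longrightarrow> Ck_fun k f"
proof (induction k arbitrary: f)
  case 0
  then show ?case using Ck_fun_continuous by fastforce
next
  case (Suc k)
  then show ?case by (metis Ck_fun.simps(2))
qed

lemma Ck_fun_const: "Ck_fun k (\<lambda>x. c)"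
  by (induction k arbitrary: c) auto

lemma Ck_fun_linear:
  assumes "bounded_linear L"
  shows "Ck_fun k L"
proof (cases k)
  case 0
  then show ?thesis by (simp add: assms linear_continuous_on)
next
  case (Suc n)
  show ?thesis unfolding Suc
    by (rule Ck_fun_SucI[OF bounded_linear_imp_has_derivative[OF assms]]) (rule Ck_fun_const)
qed

lemma Ck_fun_add:
  "Ck_fun k f \<Longrightarrow> Ck_fun k g \<Longrightarrow> Ck_fun k (\<lambda>x. f x + g x)"
proof (induction k arbitrary: f g)
  case 0
  then show ?case by (auto intro: continuous_on_add)
next
  case (Suc k)
  show ?case
    by (rule Ck_fun_SucI[OF has_derivative_add[OF Suc.prems[THEN Ck_fun_has_derivative]]])
      (use Suc in auto)
qed

lemma Ck_fun_mult:
  "Ck_fun k f \<Longrightarrow> Ck_fun k g \<Longrightarrow> Ck_fun k (\<lambda>x. f x * g x)"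
proof (induction k arbitrary: f g)
  case 0
  then show ?case by (auto intro: continuous_on_mult)
next
  case (Suc k)
  have D: "Ck_fun k (\<lambda>x. frechet_derivative f (at x) h)" "Ck_fun k (\<lambda>x. frechet_derivative g (at x) h)" for h
    using Suc.prems by auto
  show ?case
    by (rule Ck_fun_SucI[OF has_derivative_mult[OF Suc.prems[THEN Ck_fun_has_derivative]]])
      (intro Ck_fun_add Suc.IH D Suc.prems[THEN Ck_fun_Suc_imp])
qed

lemma Ck_fun_diff:
  assumes "Ck_fun k f" "Ck_fun k g"
  shows "Ck_fun k (\<lambda>x. f x - g x)"
  using Ck_fun_add[OF assms(1) Ck_fun_mult[OF Ck_fun_const[of k "-1"] assms(2)]] by simp

lemma Ck_fun_compose_linear:
  assumes L: "bounded_linear L"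
  shows "Ck_fun k f \<Longrightarrow> Ck_fun k (\<lambda>x. f (L x))"
proof (induction k arbitrary: f)
  case 0
  then show ?case
    using continuous_on_compose2[OF _ linear_continuous_on[OF L], of UNIV f UNIV] by simp
next
  case (Suc k)
  show ?case
  proof (rule Ck_fun_SucI[OF has_derivative_compose[OF bounded_linear_imp_has_derivative[OF L]
            Ck_fun_has_derivative[OF Suc.prems]]])
    show "Ck_fun k (\<lambda>x. frechet_derivative f (at (L x)) (L h))" for h
      using Suc.prems by (intro Suc.IH[of "\<lambda>y. frechet_derivative f (at y) (L h)"]) simp
  qed
qed

text \<open>For a real outer function the derivative is multiplication by the number
  \<open>f' t\<close>, so the chain rule produces a product of real functions. The induction
  generalizes over \<open>f\<close> because its hypothesis is applied to \<open>f'\<close>.\<close>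

lemma Ck_fun_compose:
  fixes f :: "real \<Rightarrow> real"
  shows "Ck_fun k f \<Longrightarrow> Ck_fun k g \<Longrightarrow> Ck_fun k (\<lambda>x. f (g x))"
proof (induction k arbitrary: f g)
  case 0
  then show ?case using continuous_on_compose2[of UNIV f UNIV g] by simp
next
  case (Suc k)
  define f' where "f' t = frechet_derivative f (at t) 1" for t
  have "frechet_derivative f (at t) h = f' t * h" for t h
    using linear_cmul[OF linear_frechet_derivative, of f "at t" h 1] Suc.prems(1)
    by (simp add: f'_def mult.commute)
  then have "frechet_derivative f (at t) = (*) (f' t)" for t by auto
  then have D: "(f has_derivative (*) (f' t)) (at t)" for t
    using Ck_fun_has_derivative[OF Suc.prems(1), of t] by simp
  show ?case
  proof (rule Ck_fun_SucI[OF has_derivative_compose[OF Ck_fun_has_derivative[OF Suc.prems(2)] D]])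
    fix h
    show "Ck_fun k (\<lambda>x. f' (g x) * frechet_derivative g (at x) h)"
      using Suc.prems
      by (intro Ck_fun_mult Suc.IH[of f' g] Ck_fun_Suc_imp[of k g]) (simp_all add: f'_def[abs_def])
  qed
qed

section \<open>Smooth cutoff functions on the line\<close>

text \<open>The classical flat function is the case \<open>n = 0\<close>. The negative powers make
  the family closed under differentiation up to linear combinations, so all orders of smoothness
  come from one induction over all \<open>n\<close>.\<close>

definition flat_exp :: "nat \<Rightarrow> real \<Rightarrow> real" where
  "flat_exp n x = (if 0 < x then exp (- 1 / x) / x ^ n else 0)"

text \<open>Substituting \<open>y = 1/x\<close> on the right reduces this to
  \<open>y^n / exp y\<close> tending to 0 at infinity.\<close>

lemma flat_exp_tendsto_0: "(flat_exp n \<longlongrightarrow> 0) (at 0)"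
proof -
  have "((\<lambda>x. inverse x ^ n / exp (inverse x)) \<longlongrightarrow> 0) (at_right (0::real))"
    using filterlim_compose[OF tendsto_power_div_exp_0 filterlim_inverse_at_top_right] .
  then have "(flat_exp n \<longlongrightarrow> 0) (at_right 0)"
    by (rule Lim_transform_eventually)
      (auto simp: flat_exp_def eventually_at_filter exp_minus field_simps)
  moreover have "(flat_exp n \<longlongrightarrow> 0) (at_left 0)"
    by (rule Lim_transform_eventually[OF tendsto_const]) (auto simp: flat_exp_def eventually_at_filter)
  ultimately show ?thesis by (simp add: filterlim_at_split)
qed

lemma DERIV_flat_exp:
  "(flat_exp n has_real_derivative flat_exp (n + 2) x - n * flat_exp (n + 1) x) (at x)"
proof -
  consider "x < 0" | "x = 0" | "0 < x" by linarith
  then show ?thesis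
  proof cases
    case 1
    have "(flat_exp n has_real_derivative 0) (at x)"
      by (rule has_field_derivative_transform_within_open[where S = "{..<0}", OF DERIV_const])
        (use 1 in \<open>auto simp: flat_exp_def\<close>)
    then show ?thesis using 1 by (simp add: flat_exp_def)
  next
    case 2
    \<comment> \<open>For nonzero \<open>h\<close> the difference quotient at 0 is exactly
      \<open>flat_exp (Suc n) h\<close>, so the previous limit applies.\<close>
    have "((\<lambda>h. (flat_exp n (0 + h) - flat_exp n 0) / h) \<longlongrightarrow> 0) (at 0)"
      by (rule Lim_transform_eventually[OF flat_exp_tendsto_0[of "Suc n"]])
        (auto simp: flat_exp_def eventually_at_filter)
    then show ?thesis using 2 by (simp add: DERIV_def flat_exp_def)
  next
    case 3
    have "((\<lambda>x. exp (- 1 / x) / x ^ n) has_real_derivative flat_exp (n + 2) x - n * flat_exp (n + 1) x) (at x)"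
      using 3 by (auto intro!: derivative_eq_intros simp: flat_exp_def field_simps)
         (cases n; simp add: field_simps power2_eq_square)
    then show ?thesis
      by (rule has_field_derivative_transform_within_open[where S = "{0<..}"])
        (use 3 in \<open>auto simp: flat_exp_def\<close>)
  qed
qed

lemma Ck_fun_flat_exp: "Ck_fun k (flat_exp n)"
proof (induction k arbitrary: n)
  case 0
  then show ?case by (auto intro!: DERIV_continuous_on DERIV_flat_exp)
next
  case (Suc k)
  show ?case
    by (rule Ck_fun_SucI[OF DERIV_flat_exp[unfolded has_field_derivative_def]])
      (intro Ck_fun_mult Ck_fun_diff Ck_fun_const Suc)
qed

text \<open>Nesting \<open>flat_exp 0\<close> in itself avoids the usual quotient of two bumps: the
  only inverse is that of a constant, so sums, products and composition suffice.\<close>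

lemma smooth_step:
  obtains s :: "real \<Rightarrow> real" where "\<And>k. Ck_fun k s"
    and "\<And>x. x \<le> 0 \<Longrightarrow> s x = 0" and "\<And>x. 1 \<le> x \<Longrightarrow> s x = 1"
proof
  \<comment> \<open>The inner \<open>flat_exp\<close> is at least its value at 1 on \<open>[1,\<infinity>)\<close>, where the outer one then vanishes
      identically.\<close>
  let ?c = "flat_exp 0 1"
  let ?s = "\<lambda>x. 1 - inverse (flat_exp 0 ?c) * flat_exp 0 (?c - flat_exp 0 x)"
  show "Ck_fun k ?s" for k
    by (intro Ck_fun_diff Ck_fun_mult Ck_fun_const
        Ck_fun_compose[OF Ck_fun_flat_exp[of k 0] Ck_fun_diff[OF Ck_fun_const Ck_fun_flat_exp]])
  show "?s x = 0" if "x \<le> 0" for x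
    using that by (simp add: flat_exp_def)
  show "?s x = 1" if "1 \<le> x" for x
    using that by (simp add: flat_exp_def)
qed

text \<open>A step rising over \<open>[a,b]\<close> times a step falling over
  \<open>[c,d]\<close>.\<close>

lemma smooth_plateau:
  fixes a b c d :: real
  assumes "a < b" "c < d"
  obtains \<theta> where "\<And>k. Ck_fun k \<theta>" and "\<And>x. \<theta> x \<noteq> 0 \<Longrightarrow> x \<in> {a..d}"
    and "\<And>x. x \<in> {b..c} \<Longrightarrow> \<theta> x = 1"
proof -
  obtain s :: "real \<Rightarrow> real" where s: "\<And>k. Ck_fun k s"
    "\<And>x. x \<le> 0 \<Longrightarrow> s x = 0" "\<And>x. 1 \<le> x \<Longrightarrow> s x = 1" by (rule smooth_step) blast
  show thesis
  proof
    let ?\<theta> = "\<lambda>x. s (inverse (b - a) * (x - a)) * s (inverse (d - c) * (d - x))"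
    have id: "Ck_fun k (\<lambda>x::real. x)" for k
      by (rule Ck_fun_linear) (rule bounded_linear_ident)
    have "Ck_fun k (\<lambda>x. inverse (b - a) * (x - a))" "Ck_fun k (\<lambda>x. inverse (d - c) * (d - x))" for k
      by (intro Ck_fun_mult Ck_fun_diff Ck_fun_const id)+
    then show "Ck_fun k ?\<theta>" for k
      by (intro Ck_fun_mult[OF Ck_fun_compose[OF s(1)] Ck_fun_compose[OF s(1)]])
    show "x \<in> {a..d}" if "?\<theta> x \<noteq> 0" for x
    proof -
      have "\<not> inverse (b - a) * (x - a) \<le> 0" "\<not> inverse (d - c) * (d - x) \<le> 0"
        using that s(2) by force+
      then show ?thesis using assms by (auto simp: not_le zero_less_mult_iff)
    qed
    show "?\<theta> x = 1" if "x \<in> {b..c}" for x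
    proof -
      have "1 \<le> inverse (b - a) * (x - a)" "1 \<le> inverse (d - c) * (d - x)"
        using that assms by (auto simp: field_simps)
      then show ?thesis by (simp add: s)
    qed
  qed
qed

section \<open>Gradients and the cone potential\<close>

lemma gradient_eqI:
  assumes "GDERIV f x :> D"
  shows "gradient f x = D"
  unfolding gradient_def
proof (rule the_equality)
  show "GDERIV f x :> D" by (rule assms)
next
  fix D' assume "GDERIV f x :> D'"
  then have "(\<lambda>h. h \<bullet> D') = (\<lambda>h. h \<bullet> D)"
    using assms unfolding gderiv_def by (rule has_derivative_unique)
  then show "D' = D" by (metis vector_eq_ldot)
qed

text \<open>Riesz representation in coordinates. The coefficients are directional derivatives,
  exactly what \<open>Ck_fun\<close> controls, whence the continuity of the gradient.\<close>

lemma GDERIV_frechet: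
  fixes f :: "'a::euclidean_space \<Rightarrow> real"
  assumes "f differentiable (at x)"
  shows "GDERIV f x :> (\<Sum>b\<in>Basis. frechet_derivative f (at x) b *\<^sub>R b)"
proof -
  have "frechet_derivative f (at x) h = h \<bullet> (\<Sum>b\<in>Basis. frechet_derivative f (at x) b *\<^sub>R b)" for h
    using linear_sum[OF linear_frechet_derivative[OF assms], of "\<lambda>b. (h \<bullet> b) *\<^sub>R b" Basis]
    by (simp add: euclidean_representation linear_frechet_derivative[OF assms] linear_cmul
        inner_sum_right mult.commute)
  then show ?thesis
    unfolding gderiv_def using assms[unfolded frechet_derivative_works] by (metis (no_types, lifting) ext)
qed

lemma continuous_on_gradient:
  assumes "Ck_fun (Suc k) f"
  shows "continuous_on UNIV (gradient f)"
proof -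
  have "gradient f = (\<lambda>x. \<Sum>b\<in>Basis. frechet_derivative f (at x) b *\<^sub>R b)"
    using assms by (auto simp: gradient_eqI[OF GDERIV_frechet])
  then show ?thesis
    using assms by (auto intro!: continuous_intros Ck_fun_continuous[of k])
qed

text \<open>The cone potential is \<open>r\<^sup>2 \<phi>(x)\<close>, cut off away from the radii that carry the measure.\<close>

lemma test_function_radial_product:
  fixes U :: "'a::euclidean_space set"
  assumes \<phi>: "\<phi> \<in> test_functions U" and UV: "U \<subseteq> V" and ab: "0 < a"
  obtains \<Phi> where "\<Phi> \<in> test_functions (V \<times> {0<..})"
    and "\<And>x r. r \<in> {a..b} \<Longrightarrow> cone_gradient \<Phi> (CPt x r) = lift_field (\<lambda>x. (gradient \<phi> x, \<phi> x)) (CPt x r)"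
proof -
  \<comment> \<open>The plateau \<open>[a/2, b+1]\<close> contains \<open>[a,b]\<close> in its
    interior, so the radial derivative sees the uncut potential even at the end points. The lower
    end \<open>a/4 > 0\<close> of the support stays away from the apex.\<close>
  obtain \<theta> where \<theta>: "\<And>k. Ck_fun k \<theta>" "\<And>x. \<theta> x \<noteq> 0 \<Longrightarrow> x \<in> {a/4..b+2}"
    "\<And>x. x \<in> {a/2..b+1} \<Longrightarrow> \<theta> x = 1"
    using smooth_plateau[of "a/4" "a/2" "b+1" "b+2"] ab by auto
  define \<Phi> where "\<Phi> z = \<phi> (fst z) * ((snd z)\<^sup>2 * \<theta> (snd z))" for z :: "'a \<times> real"
  show thesis
  proof
    have id: "Ck_fun k (snd :: 'a \<times> real \<Rightarrow> real)" for k
      by (rule Ck_fun_linear) (rule bounded_linear_snd)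
    have smooth: "Ck_fun k \<Phi>" for k
      unfolding \<Phi>_def power2_eq_square
    proof (intro Ck_fun_mult id)
      show "Ck_fun k (\<lambda>z::'a \<times> real. \<phi> (fst z))"
        using \<phi> by (intro Ck_fun_compose_linear[of fst k \<phi>] bounded_linear_fst) (simp add: test_functions_def)
      show "Ck_fun k (\<lambda>z::'a \<times> real. \<theta> (snd z))"
        using Ck_fun_compose_linear[OF bounded_linear_snd \<theta>(1)] .
    qed
    have sub: "closure {z. \<Phi> z \<noteq> 0} \<subseteq> closure {x. \<phi> x \<noteq> 0} \<times> {a/4..b+2}"
    proof (rule closure_minimal)
      show "{z. \<Phi> z \<noteq> 0} \<subseteq> closure {x. \<phi> x \<noteq> 0} \<times> {a/4..b+2}"
      proof
        fix z assume "z \<in> {z. \<Phi> z \<noteq> 0}"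
        then have "\<phi> (fst z) \<noteq> 0" "\<theta> (snd z) \<noteq> 0" by (auto simp: \<Phi>_def)
        then have "fst z \<in> closure {x. \<phi> x \<noteq> 0}" "snd z \<in> {a/4..b+2}"
          using closure_subset[of "{x. \<phi> x \<noteq> 0}"] \<theta>(2) by auto
        then show "z \<in> closure {x. \<phi> x \<noteq> 0} \<times> {a/4..b+2}" by (simp add: mem_Times_iff)
      qed
    qed (simp add: closed_Times)
    have "compact (closure {x. \<phi> x \<noteq> 0})" "closure {x. \<phi> x \<noteq> 0} \<subseteq> V"
      using \<phi> UV by (auto simp: test_functions_def compactly_inside_def)
    then have "compact (closure {x. \<phi> x \<noteq> 0} \<times> {a/4..b+2})"
      and "closure {x. \<phi> x \<noteq> 0} \<times> {a/4..b+2} \<subseteq> V \<times> {0<..}"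
      using ab by (auto simp: compact_Times)
    then have "compact (closure {z. \<Phi> z \<noteq> 0})" "closure {z. \<Phi> z \<noteq> 0} \<subseteq> V \<times> {0<..}"
      using sub compact_closure compact_imp_bounded bounded_subset closure_closure by (metis, blast)
    then show "\<Phi> \<in> test_functions (V \<times> {0<..})"
      using smooth by (simp add: test_functions_def compactly_inside_def)
  next
    fix x :: 'a and r assume r: "r \<in> {a..b}"
    have "GDERIV \<phi> x :> gradient \<phi> x"
    proof -
      have "\<phi> differentiable (at x)"
        using \<phi> Ck_fun.simps(2) unfolding test_functions_def by blast
      then show ?thesis using gradient_eqI GDERIV_frechet by metis
    qed
    moreover have eq: "(\<lambda>y. \<Phi> (y, r)) = (\<lambda>y. \<phi> y * r\<^sup>2)"
      using r ab by (simp add: \<Phi>_def \<theta>)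
    ultimately have "GDERIV (\<lambda>y. \<Phi> (y, r)) x :> r\<^sup>2 *\<^sub>R gradient \<phi> x"
      using GDERIV_mult[OF _ GDERIV_const, of \<phi> x "gradient \<phi> x" "r\<^sup>2"] by simp
    moreover have "((\<lambda>s. \<Phi> (x, s)) has_real_derivative \<phi> x * (2 * r)) (at r)"
    proof (rule has_field_derivative_transform_within_open)
      show "((\<lambda>s. \<phi> x * s\<^sup>2) has_real_derivative \<phi> x * (2 * r)) (at r)"
        by (auto intro!: derivative_eq_intros)
      show "open {a/2<..<b+1}" "r \<in> {a/2<..<b+1}" using r ab by auto
    qed (simp add: \<Phi>_def \<theta>)
    ultimately show "cone_gradient \<Phi> (CPt x r) = lift_field (\<lambda>x. (gradient \<phi> x, \<phi> x)) (CPt x r)"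
      using r ab by (simp add: gradient_eqI DERIV_imp_deriv)
  qed
qed

section \<open>Measurability on the cone\<close>

lemma CPt_in_cone_over [simp]: "CPt x r \<in> cone_over \<Omega> \<longleftrightarrow> x \<in> \<Omega> \<and> 0 < r"
  by (force simp: cone_over_def cone_class_def image_iff split: if_splits)

lemma Apex_in_cone_over [simp]: "Apex \<in> cone_over \<Omega> \<longleftrightarrow> \<Omega> \<noteq> {}"
  by (force simp: cone_over_def cone_class_def image_iff split: if_splits)

lemma openin_cone_subset: "openin (cone_topology \<Omega>) V \<Longrightarrow> V \<subseteq> cone_over \<Omega>"
  by (simp add: openin_cone_topology)

lemma space_cone_borel [simp]: "space (cone_borel \<Omega>) = cone_over \<Omega>"
  using openin_cone_subset by (auto simp: cone_borel_def intro!: space_measure_of)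

lemma space_base_borel [simp]: "space (base_borel \<Omega>) = \<Omega>"
  by (simp add: base_borel_def space_restrict_space)

lemma openin_cone_borel: "openin (cone_topology \<Omega>) V \<Longrightarrow> V \<in> sets (cone_borel \<Omega>)"
  using openin_cone_subset by (auto simp: cone_borel_def intro!: in_measure_of)

text \<open>The preimage in the product is the trace of the open set
  \<open>W \<times> {0<..}\<close>. The apex is left out because each of its neighbourhoods meets
  the rays over all base points.\<close>

lemma openin_cone_base:
  assumes "open W"
  shows "openin (cone_topology \<Omega>) {p \<in> cone_over \<Omega>. p \<noteq> Apex \<and> cone_base p \<in> W}"
proof -
  have "{z \<in> \<Omega> \<times> {0..}. cone_class z \<in> {p \<in> cone_over \<Omega>. p \<noteq> Apex \<and> cone_base p \<in> W}}
      = (\<Omega> \<times> {0..}) \<inter> (W \<times> {0<..})"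
    by (auto simp: cone_class_def split: if_splits)
  then show ?thesis
    using assms by (auto simp: openin_cone_topology openin_open intro!: exI[of _ "W \<times> {0<..}"] open_Times)
qed

lemma openin_cone_rad:
  assumes "open W"
  shows "openin (cone_topology \<Omega>) {p \<in> cone_over \<Omega>. cone_rad p \<in> W}"
proof -
  have "{z \<in> \<Omega> \<times> {0..}. cone_class z \<in> {p \<in> cone_over \<Omega>. cone_rad p \<in> W}}
      = (\<Omega> \<times> {0..}) \<inter> (UNIV \<times> W)"
    by (auto simp: cone_class_def split: if_splits)
  then show ?thesis
    using assms by (auto simp: openin_cone_topology openin_open intro!: exI[of _ "UNIV \<times> W"] open_Times)
qed

lemma cone_rad_measurable: "cone_rad \<in> borel_measurable (cone_borel \<Omega>)"
proof (rule borel_measurableI)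
  fix W :: "real set" assume "open W"
  then show "cone_rad -` W \<inter> space (cone_borel \<Omega>) \<in> sets (cone_borel \<Omega>)"
    using openin_cone_borel[OF openin_cone_rad[of W]] by (simp add: vimage_def Int_def conj_commute)
qed

lemma Apex_iff_cone_rad: "p \<in> cone_over \<Omega> \<Longrightarrow> p = Apex \<longleftrightarrow> cone_rad p = 0"
  by (cases p) auto

lemma cone_minus_Apex_sets: "cone_over \<Omega> - {Apex} \<in> sets (cone_borel \<Omega>)"
proof -
  have "cone_over \<Omega> - {Apex} = {p \<in> space (cone_borel \<Omega>). cone_rad p \<noteq> 0}"
    by (auto simp: Apex_iff_cone_rad)
  also have "\<dots> \<in> sets (cone_borel \<Omega>)"
    using cone_rad_measurable[measurable] by measurable
  finally show ?thesis .
qed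

text \<open>\<open>cone_base\<close> is unspecified at the apex; its total version takes a value in \<open>\<Omega>\<close> there, so that
  it is measurable on the whole cone.\<close>

definition base_on :: "'a set \<Rightarrow> 'a cone_point \<Rightarrow> 'a" where
  "base_on \<Omega> p = (if p = Apex then SOME x. x \<in> \<Omega> else cone_base p)"

lemma base_on_CPt [simp]: "base_on \<Omega> (CPt x r) = x"
  by (simp add: base_on_def)

lemma base_on_in: "p \<in> cone_over \<Omega> \<Longrightarrow> base_on \<Omega> p \<in> \<Omega>"
  by (cases p) (auto simp: base_on_def intro: someI)

lemma base_on_measurable: "base_on \<Omega> \<in> cone_borel \<Omega> \<rightarrow>\<^sub>M base_borel \<Omega>"
  unfolding base_borel_def
proof (rule measurable_restrict_space2)
  show "base_on \<Omega> \<in> space (cone_borel \<Omega>) \<rightarrow> \<Omega>" using base_on_in by auto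
  show "base_on \<Omega> \<in> borel_measurable (cone_borel \<Omega>)"
  proof (rule borel_measurableI)
    fix W :: "'a set" assume W: "open W"
    have "base_on \<Omega> -` W \<inter> space (cone_borel \<Omega>) = {p \<in> cone_over \<Omega>. p \<noteq> Apex \<and> cone_base p \<in> W}
      \<union> (if (SOME x. x \<in> \<Omega>) \<in> W then space (cone_borel \<Omega>) - (cone_over \<Omega> - {Apex}) else {})"
      by (auto simp: base_on_def split: if_splits)
    also have "\<dots> \<in> sets (cone_borel \<Omega>)"
      using openin_cone_borel[OF openin_cone_base[OF W]] cone_minus_Apex_sets
      by (auto simp del: space_cone_borel intro!: sets.Un sets.compl_sets)
    finally show "base_on \<Omega> -` W \<inter> space (cone_borel \<Omega>) \<in> sets (cone_borel \<Omega>)" .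
  qed
qed

text \<open>Polar coordinates, through which measurability on the cone is pulled back to a product.
  Sending negative radii to the apex makes the map total on \<open>borel\<close>. Second
  countability enters through \<open>borel_prod\<close>, which makes the open set \<open>T\<close>
  measurable for the product sigma-algebra.\<close>

lemma cone_class_measurable:
  fixes \<Omega> :: "'a::second_countable_topology set"
  shows "(\<lambda>(x, r). cone_class (x, max 0 r)) \<in> base_borel \<Omega> \<Otimes>\<^sub>M borel \<rightarrow>\<^sub>M cone_borel \<Omega>"
  unfolding cone_borel_def
proof (rule measurable_measure_of)
  show "{V. openin (cone_topology \<Omega>) V} \<subseteq> Pow (cone_over \<Omega>)"
    using openin_cone_subset by auto
  show "(\<lambda>(x, r). cone_class (x, max 0 r)) \<in> space (base_borel \<Omega> \<Otimes>\<^sub>M borel) \<rightarrow> cone_over \<Omega>"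
    by (auto simp: space_pair_measure cone_over_def)
  fix V assume "V \<in> {V. openin (cone_topology \<Omega>) V}"
  then obtain T where T: "open T" "{z \<in> \<Omega> \<times> {0..}. cone_class z \<in> V} = (\<Omega> \<times> {0..}) \<inter> T"
    by (auto simp: openin_cone_topology openin_open)
  have fst: "fst \<in> base_borel \<Omega> \<Otimes>\<^sub>M (borel :: real measure) \<rightarrow>\<^sub>M borel"
    by (rule measurable_compose[OF measurable_fst]) (simp add: base_borel_def measurable_restrict_space1)
  have "(\<lambda>(x, r). (x, max 0 r)) \<in> base_borel \<Omega> \<Otimes>\<^sub>M (borel :: real measure) \<rightarrow>\<^sub>M borel \<Otimes>\<^sub>M borel"
    using fst by (simp add: split_def)
  then have "(\<lambda>(x, r). (x, max 0 r)) -` T \<inter> space (base_borel \<Omega> \<Otimes>\<^sub>M (borel :: real measure))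
      \<in> sets (base_borel \<Omega> \<Otimes>\<^sub>M borel)"
    using T(1) by (intro measurable_sets[where A = borel]) (simp_all add: borel_prod)
  also have "(\<lambda>(x, r). (x, max 0 r)) -` T \<inter> space (base_borel \<Omega> \<Otimes>\<^sub>M (borel :: real measure))
    = (\<lambda>(x, r). cone_class (x, max 0 r)) -` V \<inter> space (base_borel \<Omega> \<Otimes>\<^sub>M (borel :: real measure))"
  proof -
    have "cone_class (x, max 0 r) \<in> V \<longleftrightarrow> (x, max 0 r) \<in> T" if "x \<in> \<Omega>" for x r
      using T(2) that by (simp add: set_eq_iff) (meson max.cobounded1)
    then show ?thesis by (auto simp: space_pair_measure)
  qed
  finally show "(\<lambda>(x, r). cone_class (x, max 0 r)) -` V \<inter> space (base_borel \<Omega> \<Otimes>\<^sub>M (borel :: real measure))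
      \<in> sets (base_borel \<Omega> \<Otimes>\<^sub>M borel)" .
qed

text \<open>The cone is a quotient of a second countable space, hence hereditarily Lindelof.\<close>

lemma AE_measure_supp_cone:
  fixes \<Omega> :: "'a::euclidean_space set"
  assumes sets: "sets \<Lambda> = sets (cone_borel \<Omega>)"
  shows "AE p in \<Lambda>. p \<in> measure_supp (cone_topology \<Omega>) \<Lambda>"
proof -
  let ?pre = "\<lambda>V. {z \<in> \<Omega> \<times> {0..}. cone_class z \<in> V}"
  define F where "F = {V. openin (cone_topology \<Omega>) V \<and> emeasure \<Lambda> V = 0}"
  have "openin (top_of_set (\<Omega> \<times> {0..})) S" if "S \<in> ?pre ` F" for S
    using that by (auto simp: F_def openin_cone_topology)
  \<comment> \<open>Lindelof is applied upstairs, to preimages of the open null sets. Since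
    \<open>cone_class\<close> maps onto the cone, the countable subcover descends, so the complement
    of the support is null.\<close>
  then obtain G where G: "G \<subseteq> ?pre ` F" "countable G" "\<Union>G = \<Union>(?pre ` F)"
    by (rule Lindelof_openin[of "?pre ` F" "\<Omega> \<times> {0..}"])
  then obtain F' where F': "F' \<subseteq> F" "countable F'" "G = ?pre ` F'"
    by (meson countable_subset_image)
  have "\<Union>F \<subseteq> \<Union>F'"
  proof
    fix p assume "p \<in> \<Union>F"
    then obtain V where V: "V \<in> F" "p \<in> V" by blast
    then have "p \<in> cone_over \<Omega>" by (auto simp: F_def openin_cone_topology)
    then obtain z where z: "z \<in> \<Omega> \<times> {0..}" "p = cone_class z" unfolding cone_over_def by blast
    then have "z \<in> \<Union>G" using V unfolding G(3) by blast
    then show "p \<in> \<Union>F'" using z(2) F'(3) by blast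
  qed
  moreover have "\<Union>F' \<in> null_sets \<Lambda>"
    using F' openin_cone_borel sets null_sets_UN'[of F' "\<lambda>V. V" \<Lambda>]
    by (auto simp: F_def null_sets_def)
  ultimately have "AE p in \<Lambda>. p \<notin> \<Union>F"
    by (auto dest!: AE_not_in elim!: eventually_mono)
  moreover have "p \<in> measure_supp (cone_topology \<Omega>) \<Lambda>" if "p \<in> space \<Lambda>" "p \<notin> \<Union>F" for p
  proof -
    have "openin (cone_topology \<Omega>) (cone_over \<Omega>)"
      using openin_cone_rad[of UNIV \<Omega>] by simp
    then have "p \<in> topspace (cone_topology \<Omega>)"
      using that(1) sets_eq_imp_space_eq[OF sets] openin_subset by auto
    then show ?thesis
      using that(2) by (auto simp: measure_supp_def F_def zero_less_iff_neq_zero)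
  qed
  ultimately show ?thesis
    using AE_space by (auto elim: eventually_elim2)
qed

section \<open>Finite measures are determined by continuous functions\<close>

text \<open>The integrands are continuous, bounded by 1 and converge to the indicator of
  \<open>C\<close>. Nonemptiness matters because \<open>infdist\<close> to the empty set is 0, which
  would give the limit 1 everywhere.\<close>

lemma measure_closed_eq_lim:
  fixes C :: "'a::metric_space set"
  assumes "finite_measure M" and sets: "sets M = sets (base_borel \<Omega>)" and C: "closed C" "C \<noteq> {}"
  shows "(\<lambda>n. \<integral>x. max 0 (1 - real n * infdist x C) \<partial>M) \<longlonglongrightarrow> measure M (C \<inter> \<Omega>)"
proof -
  interpret finite_measure M by fact
  have space: "space M = \<Omega>" using sets_eq_imp_space_eq[OF sets] by simp
  have meas: "f \<in> borel_measurable M" if "f \<in> borel_measurable borel" for f :: "'a \<Rightarrow> real"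
    using that sets by (simp add: base_borel_def measurable_restrict_space1 cong: measurable_cong_sets)
  have "(\<lambda>n. \<integral>x. max 0 (1 - real n * infdist x C) \<partial>M) \<longlonglongrightarrow> (\<integral>x. indicator C x \<partial>M)"
  proof (rule integral_dominated_convergence)
    show "(indicator C :: 'a \<Rightarrow> real) \<in> borel_measurable M"
      using C by (intro meas) simp
    show "(\<lambda>x. max 0 (1 - real n * infdist x C)) \<in> borel_measurable M" for n
      by (intro meas borel_measurable_continuous_onI continuous_intros)
    show "integrable M (\<lambda>x. 1::real)" by simp
    show "AE x in M. norm (max 0 (1 - real n * infdist x C)) \<le> 1" for n
      by (auto simp: infdist_nonneg)
    show "AE x in M. (\<lambda>n. max 0 (1 - real n * infdist x C)) \<longlonglongrightarrow> indicator C x"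
    proof (rule AE_I2)
      fix x
      show "(\<lambda>n. max 0 (1 - real n * infdist x C)) \<longlonglongrightarrow> indicator C x"
      proof (cases "x \<in> C")
        case True
        then show ?thesis by simp
      next
        case False
        then have d: "0 < infdist x C"
          using C in_closed_iff_infdist_zero infdist_nonneg by (metis order_le_less)
        obtain N where N: "1 < real N * infdist x C"
          using reals_Archimedean3[OF d] by blast
        have "1 \<le> real n * infdist x C" if "N \<le> n" for n
          using N mult_right_mono[of "real N" "real n" "infdist x C"] that d by linarith
        then have "eventually (\<lambda>n. 0 = max 0 (1 - real n * infdist x C)) sequentially"
          by (auto simp: eventually_sequentially intro!: exI[of _ N])
        then show ?thesis
          using False by (auto intro: Lim_transform_eventually[OF tendsto_const])
      qed
    qed
  qed
  also have "(\<integral>x. indicator C x \<partial>M) = measure M (C \<inter> \<Omega>)"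
    by (simp add: space)
  finally show ?thesis .
qed

text \<open>This is the uniqueness half of the definite description in
  \<open>measure_projection\<close>: equal integrals give equal masses of closed sets, and these
  generate the Borel sets.\<close>

lemma finite_measure_eqI_continuous:
  fixes \<Omega> :: "'a::metric_space set"
  assumes \<Omega>: "\<Omega> \<in> sets borel"
    and M: "finite_measure M" "sets M = sets (base_borel \<Omega>)"
    and N: "finite_measure N" "sets N = sets (base_borel \<Omega>)"
    and eq: "\<And>\<phi>::'a \<Rightarrow> real. continuous_on \<Omega> \<phi> \<Longrightarrow> (\<integral>x. \<phi> x \<partial>M) = (\<integral>x. \<phi> x \<partial>N)"
  shows "M = N"
proof -
  interpret M: finite_measure M by fact
  interpret N: finite_measure N by fact
  have id: "id \<in> measurable M borel" "id \<in> measurable N borel"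
    using M(2) N(2) by (auto simp: base_borel_def measurable_restrict_space1 cong: measurable_cong_sets)
  have space: "space M = \<Omega>" "space N = \<Omega>"
    using M(2)[THEN sets_eq_imp_space_eq] N(2)[THEN sets_eq_imp_space_eq] by auto
  have closed: "emeasure M (C \<inter> \<Omega>) = emeasure N (C \<inter> \<Omega>)" if "closed C" for C
  proof (cases "C = {}")
    case False
    have "(\<integral>x. max 0 (1 - real n * infdist x C) \<partial>M) = (\<integral>x. max 0 (1 - real n * infdist x C) \<partial>N)" for n
      by (intro eq continuous_intros)
    then have "measure M (C \<inter> \<Omega>) = measure N (C \<inter> \<Omega>)"
      using measure_closed_eq_lim[OF M that False] measure_closed_eq_lim[OF N that False]
      by (simp add: LIMSEQ_unique)
    then show ?thesis by (simp add: M.emeasure_eq_measure N.emeasure_eq_measure)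
  qed simp
  \<comment> \<open>Moving both measures to the whole space makes the closed sets an
    intersection-stable generator; since \<open>\<Omega>\<close> is Borel, measurable subsets of it
    are then recovered.\<close>
  have "distr M borel id = distr N borel id"
  proof (rule measure_eqI_generator_eq)
    show "Int_stable {C::'a set. closed C}" by (auto simp: Int_stable_def)
    show "{C::'a set. closed C} \<subseteq> Pow UNIV" by simp
    show "sets (distr M borel id) = sigma_sets UNIV {C. closed C}"
      "sets (distr N borel id) = sigma_sets UNIV {C. closed C}"
      by (simp_all add: borel_eq_closed)
    show "range (\<lambda>_::nat. UNIV) \<subseteq> {C::'a set. closed C}" by simp
    show "(\<Union>i::nat. UNIV) = (UNIV::'a set)" by simp
    show "emeasure (distr M borel id) C = emeasure (distr N borel id) C" if "C \<in> {C. closed C}" for C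
      using that closed[of C] by (simp add: emeasure_distr id space)
    show "emeasure (distr M borel id) UNIV \<noteq> \<infinity>"
      by (simp add: emeasure_distr id)
  qed
  then have D: "emeasure (distr M borel id) A = emeasure (distr N borel id) A" for A by simp
  show "M = N"
  proof (rule measure_eqI)
    show "sets M = sets N" using M N by simp
    fix A assume "A \<in> sets M"
    then have "A \<in> sets borel" "A \<subseteq> \<Omega>"
      using M(2) \<Omega> by (auto simp: base_borel_def sets_restrict_space_iff)
    then show "emeasure M A = emeasure N A"
      using D[of A] by (simp add: emeasure_distr id space Int_absorb2)
  qed
qed

section \<open>Measurability of kernels and fields\<close>

text \<open>The integrand also depends on \<open>x\<close>. Pushing \<open>L x\<close> forward along
  \<open>y \<mapsto> (x, y)\<close> moves that dependence into the kernel and leaves one fixed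
  integrand on the product.\<close>

lemma integral_kernel_measurable:
  fixes f :: "'a \<Rightarrow> 'b \<Rightarrow> 'c::{banach, second_countable_topology}"
  assumes [measurable]: "(\<lambda>(x, y). f x y) \<in> borel_measurable (M \<Otimes>\<^sub>M N)"
    and [measurable]: "L \<in> measurable M (subprob_algebra N)"
  shows "(\<lambda>x. integral\<^sup>L (L x) (f x)) \<in> borel_measurable M"
proof -
  note measurable_distr2[measurable]
  have "(\<lambda>x. integral\<^sup>L (distr (L x) (M \<Otimes>\<^sub>M N) (\<lambda>y. (x, y))) (\<lambda>(x, y). f x y)) \<in> borel_measurable M"
    by measurable
  then show ?thesis
  proof (rule measurable_cong[THEN iffD1, rotated])
    fix x assume [measurable]: "x \<in> space M"
    have [measurable_cong]: "sets (L x) = sets N"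
      using measurable_space[OF assms(2) \<open>x \<in> space M\<close>] by (simp add: space_subprob_algebra)
    have [measurable]: "Pair x \<in> L x \<rightarrow>\<^sub>M M \<Otimes>\<^sub>M N"
      using \<open>x \<in> space M\<close> by (simp cong: measurable_cong_sets)
    show "integral\<^sup>L (distr (L x) (M \<Otimes>\<^sub>M N) (\<lambda>y. (x, y))) (\<lambda>(x, y). f x y) = integral\<^sup>L (L x) (f x)"
      by (subst integral_distr) auto
  qed
qed

lemma borel_measurable_fst [measurable]:
  "fst \<in> borel_measurable (borel :: ('a::second_countable_topology \<times> 'b::second_countable_topology) measure)"
  by (simp add: borel_prod[symmetric])

lemma borel_measurable_snd [measurable]:
  "snd \<in> borel_measurable (borel :: ('a::second_countable_topology \<times> 'b::second_countable_topology) measure)"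
  by (simp add: borel_prod[symmetric])

text \<open>Pattern matching on cone points hides measurability, so the apex case is re-expressed as
  \<open>cone_rad p = 0\<close>. The same device serves
  \<open>lift_field_measurable\<close>.\<close>

lemma cone_metric_measurable:
  fixes u u' :: "'a::euclidean_space cone_point \<Rightarrow> 'a \<times> real"
  assumes [measurable]: "u \<in> borel_measurable (cone_borel \<Omega>)" "u' \<in> borel_measurable (cone_borel \<Omega>)"
  shows "(\<lambda>p. cone_metric p (u p) (u' p)) \<in> borel_measurable (cone_borel \<Omega>)"
proof -
  note cone_rad_measurable[measurable]
  have eq: "cone_metric p (u p) (u' p) = (if cone_rad p = 0 then 0
      else (cone_rad p)\<^sup>2 * (fst (u p) \<bullet> fst (u' p)) + snd (u p) * snd (u' p))" if "p \<in> cone_over \<Omega>" for p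
    using that by (cases p) auto
  show ?thesis by (subst measurable_cong[OF eq]) (simp, measurable)
qed

lemma lift_field_measurable:
  fixes w :: "'a::euclidean_space \<Rightarrow> 'a \<times> real"
  assumes [measurable]: "w \<in> borel_measurable (base_borel \<Omega>)"
  shows "lift_field w \<in> borel_measurable (cone_borel \<Omega>)"
proof -
  note cone_rad_measurable[measurable] base_on_measurable[measurable]
  have eq: "lift_field w p = (if cone_rad p = 0 then 0
      else (fst (w (base_on \<Omega> p)), 2 * snd (w (base_on \<Omega> p)) * cone_rad p))" if "p \<in> cone_over \<Omega>" for p
    using that by (cases p) auto
  show ?thesis by (subst measurable_cong[OF eq]) (simp, measurable)
qed

lemma continuous_on_base_measurable:
  "continuous_on \<Omega> f \<Longrightarrow> f \<in> borel_measurable (base_borel \<Omega>)"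
  by (simp add: base_borel_def borel_measurable_continuous_on_restrict)

lemma norm_prod_square: "(norm w)\<^sup>2 = fst w \<bullet> fst w + snd w * snd w"
  for w :: "'a::real_inner \<times> real"
  by (cases w) (simp add: norm_Pair power2_norm_eq_inner flip: power2_eq_square)

lemma HK_tangent_measurable:
  "w \<in> HK_tangent U \<mu> \<Longrightarrow> sets \<mu> = sets (base_borel \<Omega>) \<Longrightarrow> w \<in> borel_measurable (base_borel \<Omega>)"
  by (simp add: HK_tangent_def cong: measurable_cong_sets)

lemma test_function_jet_continuous:
  fixes \<phi> :: "'a::euclidean_space \<Rightarrow> real"
  assumes "\<phi> \<in> test_functions U"
  shows "continuous_on \<Omega> (\<lambda>x. (gradient \<phi> x, \<phi> x))"
proof -
  have "Ck_fun (Suc 0) \<phi>" using assms unfolding test_functions_def by blast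
  then have "continuous_on UNIV (\<lambda>x. (gradient \<phi> x, \<phi> x))"
    by (intro continuous_on_Pair continuous_on_gradient Ck_fun_continuous)
  then show ?thesis by (rule continuous_on_subset) simp
qed

text \<open>Tangent vectors are representatives, and a projected field is only almost everywhere
  equal to a known member; membership must survive such a change.\<close>

lemma HK_tangent_cong_AE:
  assumes w: "w \<in> HK_tangent U \<mu>" and w': "w' \<in> borel_measurable \<mu>"
    and eq: "AE x in \<mu>. w' x = w x" and \<mu>: "sets \<mu> = sets (base_borel \<Omega>)"
  shows "w' \<in> HK_tangent U \<mu>"
proof -
  have [measurable]: "w \<in> borel_measurable \<mu>" "w' \<in> borel_measurable \<mu>"
    using w w' by (auto simp: HK_tangent_def)
  have "integrable \<mu> (\<lambda>x. (norm (w' x))\<^sup>2) \<longleftrightarrow> integrable \<mu> (\<lambda>x. (norm (w x))\<^sup>2)"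
    by (rule integrable_cong_AE) (use eq in auto)
  moreover have "(\<integral>x. (norm (w' x - (gradient \<phi> x, \<phi> x)))\<^sup>2 \<partial>\<mu>) = (\<integral>x. (norm (w x - (gradient \<phi> x, \<phi> x)))\<^sup>2 \<partial>\<mu>)"
    if "\<phi> \<in> test_functions U" for \<phi>
  proof -
    have [measurable]: "(\<lambda>x. (gradient \<phi> x, \<phi> x)) \<in> borel_measurable \<mu>"
      using continuous_on_base_measurable[OF test_function_jet_continuous[OF that]] \<mu>
      by (simp cong: measurable_cong_sets)
    show ?thesis
      by (rule integral_cong_AE) (use eq in \<open>auto\<close>)
  qed
  ultimately show ?thesis using w w' by (simp add: HK_tangent_def)
qed

section \<open>The tangent projection\<close>

lemma tangent_projection_measurable:
  fixes u :: "'a::euclidean_space cone_point \<Rightarrow> 'a \<times> real"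
  assumes \<kappa>: "\<kappa> \<in> base_borel \<Omega> \<rightarrow>\<^sub>M prob_algebra borel" and u: "u \<in> borel_measurable (cone_borel \<Omega>)"
  shows "tangent_projection \<kappa> u \<in> borel_measurable (base_borel \<Omega>)"
proof -
  have L[measurable]: "\<kappa> \<in> base_borel \<Omega> \<rightarrow>\<^sub>M subprob_algebra borel"
    using \<kappa> by (rule measurable_prob_algebraD)
  \<comment> \<open>A version of the field that is jointly measurable on all of
    \<open>borel\<close>. It differs from \<open>u (CPt x r)\<close> only for
    \<open>r \<le> 0\<close>, where the indicator of \<open>{0<..}\<close> vanishes.\<close>
  let ?v = "\<lambda>x r. u (cone_class (x, max 0 r))"
  have [measurable]: "(\<lambda>(x, r). ?v x r) \<in> borel_measurable (base_borel \<Omega> \<Otimes>\<^sub>M borel)"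
    using measurable_compose[OF cone_class_measurable u] by (simp add: split_def)
  have v: "u (CPt x r) = ?v x r" if "0 < r" for x r
    using that by (simp add: cone_class_def)
  have "(\<lambda>x. LINT r|\<kappa> x. indicat_real {0<..} r *\<^sub>R r\<^sup>2) \<in> borel_measurable (base_borel \<Omega>)"
    by (rule integral_kernel_measurable[OF _ L]) measurable
  then have [measurable]: "(\<lambda>x. LINT r:{0<..}|\<kappa> x. r\<^sup>2) \<in> borel_measurable (base_borel \<Omega>)"
    by (simp add: set_lebesgue_integral_def)
  have "(\<lambda>x. LINT r|\<kappa> x. indicat_real {0<..} r *\<^sub>R r\<^sup>2 *\<^sub>R fst (?v x r)) \<in> borel_measurable (base_borel \<Omega>)"
    by (rule integral_kernel_measurable[OF _ L]) measurable
  moreover have "(LINT r|\<kappa> x. indicat_real {0<..} r *\<^sub>R r\<^sup>2 *\<^sub>R fst (?v x r)) =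
      (LINT r:{0<..}|\<kappa> x. r\<^sup>2 *\<^sub>R fst (u (CPt x r)))" for x
    unfolding set_lebesgue_integral_def
    by (intro Bochner_Integration.integral_cong) (auto simp: indicator_def v)
  ultimately have [measurable]:
      "(\<lambda>x. LINT r:{0<..}|\<kappa> x. r\<^sup>2 *\<^sub>R fst (u (CPt x r))) \<in> borel_measurable (base_borel \<Omega>)"
    by (simp only:)
  have "(\<lambda>x. LINT r|\<kappa> x. indicat_real {0<..} r *\<^sub>R (r * snd (?v x r))) \<in> borel_measurable (base_borel \<Omega>)"
    by (rule integral_kernel_measurable[OF _ L]) measurable
  moreover have "(LINT r|\<kappa> x. indicat_real {0<..} r *\<^sub>R (r * snd (?v x r))) =
      (LINT r:{0<..}|\<kappa> x. r * snd (u (CPt x r)))" for x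
    unfolding set_lebesgue_integral_def
    by (intro Bochner_Integration.integral_cong) (auto simp: indicator_def v)
  ultimately have [measurable]:
      "(\<lambda>x. LINT r:{0<..}|\<kappa> x. r * snd (u (CPt x r))) \<in> borel_measurable (base_borel \<Omega>)"
    by (simp only:)
  show ?thesis
    unfolding tangent_projection_def[abs_def] by measurable
qed

lemma tangent_projection_return:
  fixes u :: "'a::euclidean_space cone_point \<Rightarrow> 'a \<times> real"
  assumes \<kappa>: "\<kappa> x = return borel s" and s: "0 < s" and x: "x \<in> \<Omega>"
    and u: "u \<in> borel_measurable (cone_borel \<Omega>)"
  shows "tangent_projection \<kappa> u x = (fst (u (CPt x s)), snd (u (CPt x s)) / (2 * s))"
proof -
  let ?v = "\<lambda>r. u (cone_class (x, max 0 r))"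
  have [measurable]: "?v \<in> borel_measurable borel"
    using measurable_compose[OF measurable_Pair1' measurable_compose[OF cone_class_measurable u], of x] x
    by simp
  have v: "u (CPt x r) = ?v r" if "0 < r" for r
    using that by (simp add: cone_class_def)
  have "(LINT r:{0<..}|\<kappa> x. r\<^sup>2) = (LINT r|return borel s. indicat_real {0<..} r *\<^sub>R r\<^sup>2)"
    by (simp add: \<kappa> set_lebesgue_integral_def)
  also have "\<dots> = s\<^sup>2"
    using s by (subst integral_return) auto
  finally have 1: "(LINT r:{0<..}|\<kappa> x. r\<^sup>2) = s\<^sup>2" .
  have "(LINT r:{0<..}|\<kappa> x. r\<^sup>2 *\<^sub>R fst (u (CPt x r)))
      = (LINT r|return borel s. indicat_real {0<..} r *\<^sub>R r\<^sup>2 *\<^sub>R fst (?v r))"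
    unfolding set_lebesgue_integral_def \<kappa>
    by (intro Bochner_Integration.integral_cong) (auto simp: indicator_def v)
  also have "\<dots> = s\<^sup>2 *\<^sub>R fst (u (CPt x s))"
    using s v[OF s] by (subst integral_return) auto
  finally have 2: "(LINT r:{0<..}|\<kappa> x. r\<^sup>2 *\<^sub>R fst (u (CPt x r))) = s\<^sup>2 *\<^sub>R fst (u (CPt x s))" .
  have "(LINT r:{0<..}|\<kappa> x. r * snd (u (CPt x r)))
      = (LINT r|return borel s. indicat_real {0<..} r *\<^sub>R (r * snd (?v r)))"
    unfolding set_lebesgue_integral_def \<kappa>
    by (intro Bochner_Integration.integral_cong) (auto simp: indicator_def v)
  also have "\<dots> = s * snd (u (CPt x s))"
    using s v[OF s] by (subst integral_return) auto
  finally have 3: "(LINT r:{0<..}|\<kappa> x. r * snd (u (CPt x r))) = s * snd (u (CPt x s))" .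
  show ?thesis
    unfolding tangent_projection_def 1 2 3 using s by (simp add: power2_eq_square)
qed

lemma graph_map_measurable:
  fixes \<Omega> :: "'a::second_countable_topology set"
  assumes "\<rho> \<in> borel_measurable (base_borel \<Omega>)" and "\<forall>x\<in>\<Omega>. 0 < \<rho> x"
  shows "(\<lambda>x. CPt x (\<rho> x)) \<in> base_borel \<Omega> \<rightarrow>\<^sub>M cone_borel \<Omega>"
proof -
  have "(\<lambda>x. (x, \<rho> x)) \<in> base_borel \<Omega> \<rightarrow>\<^sub>M base_borel \<Omega> \<Otimes>\<^sub>M borel"
    using assms(1) by measurable
  from measurable_compose[OF this cone_class_measurable]
  have "(\<lambda>x. cone_class (x, max 0 (\<rho> x))) \<in> base_borel \<Omega> \<rightarrow>\<^sub>M cone_borel \<Omega>"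
    by simp
  then show ?thesis
    using assms(2) by (subst measurable_cong[where g = "\<lambda>x. cone_class (x, max 0 (\<rho> x))"])
      (auto simp: cone_class_def)
qed

lemma radial_slice_measurable:
  fixes \<Omega> :: "'a::second_countable_topology set"
  assumes B: "B \<in> sets (cone_borel \<Omega>)" and x: "x \<in> \<Omega>"
  shows "{r. 0 < r \<and> CPt x r \<in> B} \<in> sets borel"
proof -
  have "(\<lambda>r. cone_class (x, max 0 r)) \<in> borel \<rightarrow>\<^sub>M cone_borel \<Omega>"
    using measurable_compose[OF measurable_Pair1' cone_class_measurable, of x] x by simp
  from measurable_sets[OF this B]
  have "(\<lambda>r. cone_class (x, max 0 r)) -` B \<inter> {0<..} \<in> sets borel"
    by (intro sets.Int) simp_all
  also have "(\<lambda>r. cone_class (x, max 0 r)) -` B \<inter> {0<..} = {r. 0 < r \<and> CPt x r \<in> B}"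
    by (auto simp: cone_class_def)
  finally show ?thesis .
qed

lemma conditional_radial_lawD:
  assumes "conditional_radial_law \<Omega> \<Lambda> \<kappa>" "B \<in> sets \<Lambda>" "Apex \<notin> B"
  shows "emeasure \<Lambda> B = (\<integral>\<^sup>+x. emeasure (\<kappa> x) {r. 0 < r \<and> CPt x r \<in> B} \<partial>base_marginal \<Omega> \<Lambda>)"
  using assms by (simp add: conditional_radial_law_def)

lemma prob_space_eq_return:
  assumes "prob_space M" and sets: "sets M = sets N" and s: "{s} \<in> sets N" "emeasure M {s} = 1"
  shows "M = return N s"
proof (rule measure_eqI)
  interpret prob_space M by fact
  have "AE y in M. y \<in> {s}"
    using s sets by (subst AE_in_set_eq_1) (simp_all add: measure_def)
  then show "emeasure M A = emeasure (return N s) A" if "A \<in> sets M" for A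
  proof -
    have "emeasure M A = (\<integral>\<^sup>+y. indicator A y \<partial>M)"
      using that by simp
    also have "\<dots> = (\<integral>\<^sup>+y. indicator A s \<partial>M)"
      using \<open>AE y in M. y \<in> {s}\<close> by (intro nn_integral_cong_AE) auto
    also have "\<dots> = emeasure (return N s) A"
      using that sets by (simp add: emeasure_space_1)
    finally show ?thesis .
  qed
qed (simp add: sets)

section \<open>Measures on the cone with bounded radii\<close>

locale radial_cone_measure =
  fixes \<Omega> :: "'a::euclidean_space set" and \<Lambda> :: "'a cone_point measure" and rmin rmax :: real
  assumes compact_base: "compact \<Omega>" and cone_measure: "\<Lambda> \<in> cone_measures \<Omega>"
    and rmin_pos: "0 < rmin" and radial: "radially_supported \<Omega> rmin rmax \<Lambda>"
begin

lemma sets_\<Lambda> [measurable_cong]: "sets \<Lambda> = sets (cone_borel \<Omega>)"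
  and finite_\<Lambda>: "finite_measure \<Lambda>"
  and integrable_rad: "integrable \<Lambda> (\<lambda>p. (cone_rad p)\<^sup>2)"
  using cone_measure by (auto simp: cone_measures_def)

lemma space_\<Lambda>: "space \<Lambda> = cone_over \<Omega>"
  using sets_eq_imp_space_eq[OF sets_\<Lambda>] by simp

lemmas cone_measurable [measurable] = cone_rad_measurable[of \<Omega>] base_on_measurable[of \<Omega>]

text \<open>The only place where the radial support is used. Almost every point is a genuine
  \<open>CPt\<close> with controlled radius, so the dummy values at the apex never matter
  afterwards.\<close>

lemma AE_cone:
  "AE p in \<Lambda>. base_on \<Omega> p \<in> \<Omega> \<and> p = CPt (base_on \<Omega> p) (cone_rad p) \<and> rmin \<le> cone_rad p \<and> cone_rad p \<le> rmax"
proof -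
  have "base_on \<Omega> p \<in> \<Omega> \<and> p = CPt (base_on \<Omega> p) (cone_rad p) \<and> rmin \<le> cone_rad p \<and> cone_rad p \<le> rmax"
    if "p \<in> measure_supp (cone_topology \<Omega>) \<Lambda>" for p
  proof -
    have "p \<in> cone_over \<Omega>" "rmin \<le> cone_rad p" "cone_rad p \<le> rmax"
      using that radial unfolding radially_supported_def by auto
    then show ?thesis using rmin_pos by (cases p) auto
  qed
  then show ?thesis using AE_measure_supp_cone[OF sets_\<Lambda>] by (auto elim: AE_mp)
qed

section \<open>The projected measure and its null sets\<close>

definition proj :: "'a measure" where
  "proj = distr (density \<Lambda> (\<lambda>p. ennreal ((cone_rad p)\<^sup>2))) (base_borel \<Omega>) (base_on \<Omega>)"

lemma sets_proj [measurable_cong]: "sets proj = sets (base_borel \<Omega>)"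
  by (simp add: proj_def)

lemma space_proj: "space proj = \<Omega>"
  by (simp add: proj_def)

lemma
  fixes f :: "'a \<Rightarrow> real"
  assumes [measurable]: "f \<in> borel_measurable (base_borel \<Omega>)"
  shows integral_proj: "(\<integral>x. f x \<partial>proj) = (\<integral>p. (cone_rad p)\<^sup>2 * f (base_on \<Omega> p) \<partial>\<Lambda>)"
    and integrable_proj: "integrable proj f \<longleftrightarrow> integrable \<Lambda> (\<lambda>p. (cone_rad p)\<^sup>2 * f (base_on \<Omega> p))"
  by (simp_all add: proj_def integral_distr integrable_distr_eq integral_density integrable_density)

lemma finite_proj: "finite_measure proj"
proof (rule finite_measureI)
  have "integrable proj (\<lambda>x. 1::real)"
    using integrable_rad by (subst integrable_proj) auto
  then show "emeasure proj (space proj) \<noteq> \<infinity>"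
    by (simp add: integrable_iff_bounded)
qed

text \<open>Existence is the change of variables in \<open>integral_proj\<close>, where
  \<open>base_on\<close> and \<open>cone_base\<close> may be exchanged because the weight vanishes
  at the apex. Uniqueness uses that the compact set \<open>\<Omega>\<close> is closed, hence
  Borel.\<close>

lemma measure_projection_eq: "measure_projection \<Omega> \<Lambda> = proj"
  unfolding measure_projection_def
proof (rule the_equality)
  have weight: "(cone_rad p)\<^sup>2 * \<phi> (base_on \<Omega> p) = (cone_rad p)\<^sup>2 * \<phi> (cone_base p)" for p and \<phi> :: "'a \<Rightarrow> real"
    by (cases p) auto
  show P: "sets proj = sets (base_borel \<Omega>) \<and> finite_measure proj \<and>
     (\<forall>\<phi>::'a \<Rightarrow> real. continuous_on \<Omega> \<phi> \<longrightarrow>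
        (\<integral>x. \<phi> x \<partial>proj) = (\<integral>p. (cone_rad p)\<^sup>2 * \<phi> (cone_base p) \<partial>\<Lambda>))"
    using finite_proj by (auto simp: sets_proj integral_proj continuous_on_base_measurable weight)
  fix \<mu> assume "sets \<mu> = sets (base_borel \<Omega>) \<and> finite_measure \<mu> \<and>
     (\<forall>\<phi>::'a \<Rightarrow> real. continuous_on \<Omega> \<phi> \<longrightarrow>
        (\<integral>x. \<phi> x \<partial>\<mu>) = (\<integral>p. (cone_rad p)\<^sup>2 * \<phi> (cone_base p) \<partial>\<Lambda>))"
  then show "\<mu> = proj"
    using P compact_base by (intro finite_measure_eqI_continuous[of \<Omega>])
      (auto intro: borel_closed compact_imp_closed)
qed

text \<open>The density \<open>r^2\<close> is positive almost everywhere, so weighting creates no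
  new null sets.\<close>

lemma AE_proj_iff:
  assumes "{x \<in> \<Omega>. P x} \<in> sets (base_borel \<Omega>)"
  shows "(AE x in proj. P x) \<longleftrightarrow> (AE p in \<Lambda>. P (base_on \<Omega> p))"
proof -
  have "(AE x in proj. P x) \<longleftrightarrow> (AE p in \<Lambda>. 0 < ennreal ((cone_rad p)\<^sup>2) \<longrightarrow> P (base_on \<Omega> p))"
    unfolding proj_def using assms by (subst AE_distr_iff) (simp_all add: AE_density)
  also have "\<dots> \<longleftrightarrow> (AE p in \<Lambda>. P (base_on \<Omega> p))"
    by (rule eventually_subst, use AE_cone in eventually_elim) (use rmin_pos in simp)
  finally show ?thesis .
qed

text \<open>This direction holds without measurability of \<open>P\<close>: the exceptional set is
  enlarged to a measurable null set \<open>N\<close>, to which the equivalence applies.\<close>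

lemma AE_proj_D:
  assumes "AE x in proj. P x"
  shows "AE p in \<Lambda>. P (base_on \<Omega> p)"
proof -
  obtain N where N: "{x \<in> space proj. \<not> P x} \<subseteq> N" "emeasure proj N = 0" "N \<in> sets proj"
    using AE_E[OF assms] .
  have "{x \<in> \<Omega>. x \<notin> N} = space proj - N" by (auto simp: space_proj)
  then have "{x \<in> \<Omega>. x \<notin> N} \<in> sets (base_borel \<Omega>)"
    using N(3) sets_proj by (metis sets.compl_sets)
  moreover have "AE x in proj. x \<notin> N"
    using N by (intro AE_not_in) (simp add: null_sets_def)
  ultimately have "AE p in \<Lambda>. base_on \<Omega> p \<notin> N"
    by (simp add: AE_proj_iff)
  then show ?thesis
    using AE_cone by eventually_elim (use N(1) space_proj in auto)
qed

text \<open>Removing the apex changes nothing, because it is a null set, and outside it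
  \<open>base_on\<close> and \<open>cone_base\<close> agree.\<close>

lemma base_marginal_eq: "base_marginal \<Omega> \<Lambda> = distr \<Lambda> (base_borel \<Omega>) (base_on \<Omega>)"
proof (rule measure_eqI)
  show "sets (base_marginal \<Omega> \<Lambda>) = sets (distr \<Lambda> (base_borel \<Omega>) (base_on \<Omega>))"
    by (simp add: base_marginal_def)
  let ?R = "restrict_space \<Lambda> (cone_over \<Omega> - {Apex})"
  have space: "space ?R = cone_over \<Omega> - {Apex}"
    by (auto simp: space_restrict_space space_\<Lambda>)
  have meas: "cone_base \<in> ?R \<rightarrow>\<^sub>M base_borel \<Omega>"
  proof (subst measurable_cong)
    show "cone_base p = base_on \<Omega> p" if "p \<in> space ?R" for p
      using that by (auto simp: space base_on_def)
    show "base_on \<Omega> \<in> ?R \<rightarrow>\<^sub>M base_borel \<Omega>"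
      by (intro measurable_restrict_space1) measurable
  qed
  fix A assume "A \<in> sets (base_marginal \<Omega> \<Lambda>)"
  then have A[measurable]: "A \<in> sets (base_borel \<Omega>)" by (simp add: base_marginal_def)
  have "emeasure (base_marginal \<Omega> \<Lambda>) A = emeasure ?R (cone_base -` A \<inter> space ?R)"
    using meas A by (simp add: base_marginal_def emeasure_distr)
  also have "\<dots> = emeasure \<Lambda> (cone_base -` A \<inter> space ?R)"
    using cone_minus_Apex_sets[of \<Omega>] sets_\<Lambda> space_\<Lambda> sets.top[of \<Lambda>]
    by (subst emeasure_restrict_space) (auto simp: space intro!: sets.Int)
  also have "cone_base -` A \<inter> space ?R = base_on \<Omega> -` A \<inter> space ?R"
    by (auto simp: space base_on_def)
  also have "emeasure \<Lambda> (base_on \<Omega> -` A \<inter> space ?R) = emeasure \<Lambda> (base_on \<Omega> -` A \<inter> space \<Lambda>)"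
  proof (rule emeasure_eq_AE)
    show "AE p in \<Lambda>. p \<in> base_on \<Omega> -` A \<inter> space ?R \<longleftrightarrow> p \<in> base_on \<Omega> -` A \<inter> space \<Lambda>"
      using AE_cone AE_space by eventually_elim (auto simp: space space_\<Lambda>)
    show sets: "base_on \<Omega> -` A \<inter> space \<Lambda> \<in> sets \<Lambda>" by measurable
    have "base_on \<Omega> -` A \<inter> space ?R = (base_on \<Omega> -` A \<inter> space \<Lambda>) \<inter> (cone_over \<Omega> - {Apex})"
      by (auto simp: space space_\<Lambda>)
    then show "base_on \<Omega> -` A \<inter> space ?R \<in> sets \<Lambda>"
      using sets cone_minus_Apex_sets[of \<Omega>] sets_\<Lambda> by auto
  qed
  also have "\<dots> = emeasure (distr \<Lambda> (base_borel \<Omega>) (base_on \<Omega>)) A"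
    by (simp add: emeasure_distr)
  finally show "emeasure (base_marginal \<Omega> \<Lambda>) A = emeasure (distr \<Lambda> (base_borel \<Omega>) (base_on \<Omega>)) A" .
qed

text \<open>Both measures are images under \<open>base_on\<close>, one of \<open>\<Lambda>\<close>
  and one of its version with density \<open>r^2\<close>. A null set of the marginal is pulled back
  to the cone and transferred with \<open>AE_proj_iff\<close>.\<close>

lemma AE_base_marginal_proj:
  assumes "AE x in base_marginal \<Omega> \<Lambda>. P x"
  shows "AE x in proj. P x"
proof -
  obtain N where N: "{x \<in> space (base_marginal \<Omega> \<Lambda>). \<not> P x} \<subseteq> N"
      "emeasure (base_marginal \<Omega> \<Lambda>) N = 0" "N \<in> sets (base_marginal \<Omega> \<Lambda>)"
    using AE_E[OF assms] .
  have space: "space (base_marginal \<Omega> \<Lambda>) = \<Omega>" by (simp add: base_marginal_def)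
  have "AE x in distr \<Lambda> (base_borel \<Omega>) (base_on \<Omega>). x \<notin> N"
    using N unfolding base_marginal_eq by (intro AE_not_in) (simp add: null_sets_def)
  then have "AE p in \<Lambda>. base_on \<Omega> p \<notin> N"
    by (rule AE_distrD[rotated]) measurable
  moreover have "{x \<in> \<Omega>. x \<notin> N} \<in> sets (base_borel \<Omega>)"
  proof -
    have "{x \<in> \<Omega>. x \<notin> N} = space (base_borel \<Omega>) - N" by auto
    then show ?thesis using N(3) by (simp add: base_marginal_def sets.compl_sets del: space_base_borel)
  qed
  ultimately have "AE x in proj. x \<notin> N" by (simp add: AE_proj_iff)
  then show ?thesis
    using AE_space by eventually_elim (use N(1) space space_proj in auto)
qed

section \<open>The lifting as an isometry into the cone tangent space\<close>

lemma AE_lift_field: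
  "AE p in \<Lambda>. lift_field w p = (fst (w (base_on \<Omega> p)), 2 * snd (w (base_on \<Omega> p)) * cone_rad p)"
  using AE_cone
proof eventually_elim
  case (elim p)
  then show ?case by (cases p) auto
qed

text \<open>Well-definedness and injectivity on classes: the scalar component is multiplied by
  \<open>2r\<close>, and \<open>r \<ge> rmin > 0\<close> allows cancellation.\<close>

lemma lift_field_AE_eq_iff:
  assumes [measurable]: "w \<in> borel_measurable (base_borel \<Omega>)" "w' \<in> borel_measurable (base_borel \<Omega>)"
  shows "(AE p in \<Lambda>. lift_field w p = lift_field w' p) \<longleftrightarrow> (AE x in proj. w x = w' x)"
proof -
  have "{x \<in> space (base_borel \<Omega>). w x = w' x} \<in> sets (base_borel \<Omega>)" by measurable
  then have "(AE x in proj. w x = w' x) \<longleftrightarrow> (AE p in \<Lambda>. w (base_on \<Omega> p) = w' (base_on \<Omega> p))"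
    by (subst AE_proj_iff) simp_all
  also have "\<dots> \<longleftrightarrow> (AE p in \<Lambda>. lift_field w p = lift_field w' p)"
  proof (rule eventually_subst)
    show "AE p in \<Lambda>. (w (base_on \<Omega> p) = w' (base_on \<Omega> p)) = (lift_field w p = lift_field w' p)"
      using AE_cone AE_lift_field[of w] AE_lift_field[of w']
      by eventually_elim (use rmin_pos in \<open>auto simp: prod_eq_iff\<close>)
  qed
  finally show ?thesis ..
qed

lemma lift_field_AE_congD:
  assumes "AE x in proj. w x = w' x"
  shows "AE p in \<Lambda>. lift_field w p = lift_field w' p"
  using AE_proj_D[OF assms] AE_lift_field[of w] AE_lift_field[of w'] by eventually_elim simp

lemma AE_cone_metric_lift:
  "AE p in \<Lambda>. cone_metric p (lift_field w p) (lift_field w' p) =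
    (cone_rad p)\<^sup>2 * (fst (w (base_on \<Omega> p)) \<bullet> fst (w' (base_on \<Omega> p)) +
      4 * snd (w (base_on \<Omega> p)) * snd (w' (base_on \<Omega> p)))"
  using AE_cone
proof eventually_elim
  case (elim p)
  then show ?case by (cases p) (auto simp: algebra_simps power2_eq_square)
qed

text \<open>The fields need only be lifts almost everywhere, so the identity serves both the lifting
  and, read backwards, the projection.\<close>

lemma cone_inner_lift:
  assumes [measurable]: "w \<in> borel_measurable (base_borel \<Omega>)" "w' \<in> borel_measurable (base_borel \<Omega>)"
    and u: "u \<in> borel_measurable \<Lambda>" "u' \<in> borel_measurable \<Lambda>"
    and eq: "AE p in \<Lambda>. u p = lift_field w p" "AE p in \<Lambda>. u' p = lift_field w' p"
  shows "cone_inner \<Lambda> u u' = HK_inner proj w w'"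
proof -
  have [measurable]: "(\<lambda>p. cone_metric p (u p) (u' p)) \<in> borel_measurable \<Lambda>"
    using cone_metric_measurable[of u \<Omega> u'] u by (simp cong: measurable_cong_sets add: sets_\<Lambda>)
  have "cone_inner \<Lambda> u u' = (\<integral>p. (cone_rad p)\<^sup>2 * (fst (w (base_on \<Omega> p)) \<bullet> fst (w' (base_on \<Omega> p)) +
      4 * snd (w (base_on \<Omega> p)) * snd (w' (base_on \<Omega> p))) \<partial>\<Lambda>)"
    unfolding cone_inner_def
  proof (rule integral_cong_AE)
    show "AE p in \<Lambda>. cone_metric p (u p) (u' p) = (cone_rad p)\<^sup>2 * (fst (w (base_on \<Omega> p)) \<bullet> fst (w' (base_on \<Omega> p)) +
      4 * snd (w (base_on \<Omega> p)) * snd (w' (base_on \<Omega> p)))"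
      using eq AE_cone_metric_lift[of w w'] by eventually_elim simp
  qed measurable
  also have "\<dots> = HK_inner proj w w'"
    unfolding HK_inner_def by (rule integral_proj[symmetric]) measurable
  finally show ?thesis .
qed

lemma integrable_cone_metric_lift:
  assumes [measurable]: "w \<in> borel_measurable (base_borel \<Omega>)"
    and w2: "integrable proj (\<lambda>x. (norm (w x))\<^sup>2)"
    and u: "u \<in> borel_measurable \<Lambda>" and eq: "AE p in \<Lambda>. u p = lift_field w p"
  shows "integrable \<Lambda> (\<lambda>p. cone_metric p (u p) (u p))"
proof -
  have "integrable proj (\<lambda>x. 4 * (norm (w x))\<^sup>2)" using w2 by simp
  then have "integrable proj (\<lambda>x. fst (w x) \<bullet> fst (w x) + 4 * snd (w x) * snd (w x))"
    by (rule Bochner_Integration.integrable_bound) (auto simp: norm_prod_square intro!: AE_I2)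
  then have "integrable \<Lambda> (\<lambda>p. (cone_rad p)\<^sup>2 * (fst (w (base_on \<Omega> p)) \<bullet> fst (w (base_on \<Omega> p)) +
      4 * snd (w (base_on \<Omega> p)) * snd (w (base_on \<Omega> p))))"
    by (subst (asm) integrable_proj) measurable
  moreover have [measurable]: "(\<lambda>p. cone_metric p (u p) (u p)) \<in> borel_measurable \<Lambda>"
    using cone_metric_measurable[of u \<Omega> u] u by (simp cong: measurable_cong_sets add: sets_\<Lambda>)
  moreover have "AE p in \<Lambda>. (cone_rad p)\<^sup>2 * (fst (w (base_on \<Omega> p)) \<bullet> fst (w (base_on \<Omega> p)) +
      4 * snd (w (base_on \<Omega> p)) * snd (w (base_on \<Omega> p))) = cone_metric p (u p) (u p)"
    using eq AE_cone_metric_lift[of w w] by eventually_elim simp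
  ultimately show ?thesis
    by (subst integrable_cong_AE[symmetric, where f = "\<lambda>p. (cone_rad p)\<^sup>2 * (fst (w (base_on \<Omega> p)) \<bullet> fst (w (base_on \<Omega> p)) +
      4 * snd (w (base_on \<Omega> p)) * snd (w (base_on \<Omega> p)))"]) measurable
qed

text \<open>The lift is linear, and on radii in \<open>[rmin, rmax]\<close> the cone gradient of the
  cut-off potential is the lift of \<open>(gradient \<phi>, \<phi>)\<close>. Hence \<open>u\<close>
  minus this gradient is almost everywhere the lift of the approximation error on the base, whose
  size is preserved.\<close>

lemma lift_range_subset_cone_tangent:
  assumes U: "U \<subseteq> interior \<Omega>"
  shows "lift_range U proj \<Lambda> \<subseteq> cone_tangent \<Omega> \<Lambda>"
proof
  fix u assume "u \<in> lift_range U proj \<Lambda>"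
  then obtain w where u: "u \<in> borel_measurable \<Lambda>" and w: "w \<in> HK_tangent U proj"
    and eq: "AE p in \<Lambda>. u p = lift_field w p" by (auto simp: lift_range_def)
  have wm[measurable]: "w \<in> borel_measurable (base_borel \<Omega>)"
    using w sets_proj by (rule HK_tangent_measurable)
  have w2: "integrable proj (\<lambda>x. (norm (w x))\<^sup>2)" using w by (simp add: HK_tangent_def)
  have "u \<in> cone_L2 \<Lambda>"
    using u integrable_cone_metric_lift[OF wm w2 u eq] by (simp add: cone_L2_def)
  moreover have "\<exists>\<Phi>\<in>test_functions (interior \<Omega> \<times> {0<..}).
     (\<integral>p. cone_metric p (u p - cone_gradient \<Phi> p) (u p - cone_gradient \<Phi> p) \<partial>\<Lambda>) < \<epsilon>" if "0 < \<epsilon>" for \<epsilon>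
  proof -
    \<comment> \<open>The tensor is at most 4 times the squared norm used in
      \<open>HK_tangent\<close>.\<close>
    have "0 < \<epsilon> / 4" using that by simp
    then obtain \<phi> where \<phi>: "\<phi> \<in> test_functions U"
      and less: "(\<integral>x. (norm (w x - (gradient \<phi> x, \<phi> x)))\<^sup>2 \<partial>proj) < \<epsilon> / 4"
      using w unfolding HK_tangent_def by blast
    obtain \<Phi> where \<Phi>: "\<Phi> \<in> test_functions (interior \<Omega> \<times> {0<..})"
      and grad: "\<And>x r. r \<in> {rmin..rmax} \<Longrightarrow>
        cone_gradient \<Phi> (CPt x r) = lift_field (\<lambda>x. (gradient \<phi> x, \<phi> x)) (CPt x r)"
      by (rule test_function_radial_product[where b = rmax, OF \<phi> U rmin_pos]) (rule that; blast)
    define g where "g = (\<lambda>x. (gradient \<phi> x, \<phi> x))"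
    have g: "continuous_on \<Omega> g"
      unfolding g_def using \<phi> by (rule test_function_jet_continuous)
    then have [measurable]: "g \<in> borel_measurable (base_borel \<Omega>)"
      by (rule continuous_on_base_measurable)
    let ?d = "\<lambda>x. w x - g x"
    have dm[measurable]: "?d \<in> borel_measurable (base_borel \<Omega>)" by measurable
    have lm: "lift_field ?d \<in> borel_measurable \<Lambda>"
      using lift_field_measurable[OF dm] by (simp cong: measurable_cong_sets add: sets_\<Lambda>)
    let ?D = "\<lambda>p. u p - cone_gradient \<Phi> p"
    have D: "AE p in \<Lambda>. ?D p = lift_field ?d p"
      using AE_cone eq
    proof eventually_elim
      case (elim p)
      then show ?case
        using grad[of "cone_rad p" "base_on \<Omega> p"] by (cases p) (auto simp: g_def algebra_simps)
    qed
    \<comment> \<open>The final comparison of integrals needs an integrable upper bound. Here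
      \<open>g\<close> is continuous on a compact set, hence bounded, and the measure is
      finite.\<close>
    have int: "integrable proj (\<lambda>x. (norm (?d x))\<^sup>2)"
    proof -
      interpret finite_measure proj by (rule finite_proj)
      obtain K where K: "\<And>x. x \<in> \<Omega> \<Longrightarrow> norm (g x) \<le> K"
        using compact_imp_bounded[OF compact_continuous_image[OF g compact_base]]
        by (auto simp: bounded_iff)
      have "integrable proj (\<lambda>x. 2 * (norm (w x))\<^sup>2 + 2 * K\<^sup>2)" using w2 by simp
      then show ?thesis
      proof (rule Bochner_Integration.integrable_bound)
        show "AE x in proj. norm ((norm (?d x))\<^sup>2) \<le> norm (2 * (norm (w x))\<^sup>2 + 2 * K\<^sup>2)"
        proof (rule AE_I2)
          fix x assume "x \<in> space proj"
          then have "norm (?d x) \<le> norm (w x) + K"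
            using K[of x] norm_triangle_ineq4[of "w x" "g x"] by (simp add: space_proj)
          then have "(norm (?d x))\<^sup>2 \<le> (norm (w x) + K)\<^sup>2" by (rule power_mono) simp
          also have "\<dots> \<le> 2 * (norm (w x))\<^sup>2 + 2 * K\<^sup>2"
            using sum_squares_bound[of "norm (w x)" K] by (simp add: power2_sum)
          finally show "norm ((norm (?d x))\<^sup>2) \<le> norm (2 * (norm (w x))\<^sup>2 + 2 * K\<^sup>2)" by simp
        qed
      qed measurable
    qed
    have "(\<integral>p. cone_metric p (?D p) (?D p) \<partial>\<Lambda>) < \<epsilon>"
    proof (cases "integrable \<Lambda> (\<lambda>p. cone_metric p (?D p) (?D p))")
      case False
      \<comment> \<open>No measurability of the cone gradient is needed: the integral is then 0 by convention.\<close>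
      then show ?thesis using that by (simp add: not_integrable_integral_eq)
    next
      case True
      have "(\<integral>p. cone_metric p (?D p) (?D p) \<partial>\<Lambda>) = cone_inner \<Lambda> (lift_field ?d) (lift_field ?d)"
        unfolding cone_inner_def
      proof (rule integral_cong_AE)
        show "(\<lambda>p. cone_metric p (?D p) (?D p)) \<in> borel_measurable \<Lambda>" using True by simp
        show "(\<lambda>p. cone_metric p (lift_field ?d p) (lift_field ?d p)) \<in> borel_measurable \<Lambda>"
          using lm cone_metric_measurable by (simp cong: measurable_cong_sets add: sets_\<Lambda>)
        show "AE p in \<Lambda>. cone_metric p (?D p) (?D p) = cone_metric p (lift_field ?d p) (lift_field ?d p)"
          using D by eventually_elim simp
      qed
      also have "\<dots> = HK_inner proj ?d ?d"
        by (rule cone_inner_lift[OF dm dm lm lm]) simp_all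
      also have "\<dots> \<le> (\<integral>x. 4 * (norm (?d x))\<^sup>2 \<partial>proj)"
        unfolding HK_inner_def
      proof (rule integral_mono')
        show "integrable proj (\<lambda>x. 4 * (norm (?d x))\<^sup>2)" using int by simp
        show "fst (?d x) \<bullet> fst (?d x) + 4 * snd (?d x) * snd (?d x) \<le> 4 * (norm (?d x))\<^sup>2" for x
          using inner_ge_zero[of "fst (?d x)"] unfolding norm_prod_square by (simp only: distrib_left mult.assoc)
      qed simp
      also have "\<dots> < \<epsilon>"
        using less by (simp add: g_def)
      finally show ?thesis .
    qed
    then show ?thesis using \<Phi> by blast
  qed
  ultimately show "u \<in> cone_tangent \<Omega> \<Lambda>" by (simp add: cone_tangent_def)
qed

lemma lift_field_in_lift_range:
  assumes w: "w \<in> HK_tangent U proj"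
  shows "lift_field w \<in> lift_range U proj \<Lambda>"
  using lift_field_measurable[OF HK_tangent_measurable[OF w sets_proj]] w
  by (auto simp: lift_range_def sets_\<Lambda> cong: measurable_cong_sets)

lemma ae_isometry_lift_field:
  "ae_isometry proj (HK_tangent U proj) (HK_inner proj) \<Lambda> (lift_range U proj \<Lambda>) (cone_inner \<Lambda>) lift_field"
  unfolding ae_isometry_def
proof (intro conjI ballI allI)
  fix w w' c assume w: "w \<in> HK_tangent U proj" "w' \<in> HK_tangent U proj"
  note m = w[THEN HK_tangent_measurable[OF _ sets_proj]]
  show "(AE p in \<Lambda>. lift_field w p = lift_field w' p) \<longleftrightarrow> (AE x in proj. w x = w' x)"
    by (rule lift_field_AE_eq_iff[OF m])
  show "AE p in \<Lambda>. lift_field (\<lambda>x. w x + c *\<^sub>R w' x) p = lift_field w p + c *\<^sub>R lift_field w' p"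
  proof (rule AE_I2)
    show "lift_field (\<lambda>x. w x + c *\<^sub>R w' x) p = lift_field w p + c *\<^sub>R lift_field w' p" for p
      by (cases p) (auto simp: algebra_simps)
  qed
  show "cone_inner \<Lambda> (lift_field w) (lift_field w') = HK_inner proj w w'"
    using w[THEN lift_field_in_lift_range] by (intro cone_inner_lift m) (auto simp: lift_range_def)
next
  fix u assume "u \<in> lift_range U proj \<Lambda>"
  then obtain w where "w \<in> HK_tangent U proj" "AE p in \<Lambda>. u p = lift_field w p"
    by (auto simp: lift_range_def)
  then show "\<exists>w\<in>HK_tangent U proj. AE p in \<Lambda>. lift_field w p = u p"
    by (auto simp: eq_commute)
qed (rule lift_field_in_lift_range)

section \<open>Graph measures and their conditional radial laws\<close>

lemma graph_measureD:
  assumes "graph_measure \<Omega> \<Lambda> \<eta> \<rho>"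
  shows "sets \<eta> = sets (base_borel \<Omega>)" and "space \<eta> = \<Omega>"
    and "(\<lambda>x. CPt x (\<rho> x)) \<in> \<eta> \<rightarrow>\<^sub>M cone_borel \<Omega>"
    and "\<Lambda> = distr \<eta> (cone_borel \<Omega>) (\<lambda>x. CPt x (\<rho> x))"
proof -
  show sets: "sets \<eta> = sets (base_borel \<Omega>)" using assms by (simp add: graph_measure_def)
  show "space \<eta> = \<Omega>" using sets_eq_imp_space_eq[OF sets] by simp
  show "(\<lambda>x. CPt x (\<rho> x)) \<in> \<eta> \<rightarrow>\<^sub>M cone_borel \<Omega>"
    using assms graph_map_measurable sets by (auto simp: graph_measure_def cong: measurable_cong_sets)
  show "\<Lambda> = distr \<eta> (cone_borel \<Omega>) (\<lambda>x. CPt x (\<rho> x))" using assms by (simp add: graph_measure_def)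
qed

lemma graph_emeasure:
  assumes "graph_measure \<Omega> \<Lambda> \<eta> \<rho>" and "B \<in> sets \<Lambda>"
  shows "emeasure \<Lambda> B = emeasure \<eta> {x \<in> \<Omega>. CPt x (\<rho> x) \<in> B}"
proof -
  note g = graph_measureD[OF assms(1)]
  have "emeasure \<Lambda> B = emeasure (distr \<eta> (cone_borel \<Omega>) (\<lambda>x. CPt x (\<rho> x))) B"
    using g(4) by simp
  also have "\<dots> = emeasure \<eta> ((\<lambda>x. CPt x (\<rho> x)) -` B \<inter> space \<eta>)"
    using assms(2) by (intro emeasure_distr g(3)) (simp add: sets_\<Lambda>)
  also have "(\<lambda>x. CPt x (\<rho> x)) -` B \<inter> space \<eta> = {x \<in> \<Omega>. CPt x (\<rho> x) \<in> B}"
    using g(2) by auto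
  finally show ?thesis .
qed

lemma graph_AE:
  assumes "graph_measure \<Omega> \<Lambda> \<eta> \<rho>" and "AE p in \<Lambda>. P p"
  shows "AE x in \<eta>. P (CPt x (\<rho> x))"
proof -
  note g = graph_measureD[OF assms(1)]
  have "AE p in distr \<eta> (cone_borel \<Omega>) (\<lambda>x. CPt x (\<rho> x)). P p"
    by (subst g(4)[symmetric]) (rule assms(2))
  then show ?thesis by (rule AE_distrD[OF g(3)])
qed

text \<open>The graph map followed by \<open>base_on\<close> is the identity, so
  \<open>\<eta>\<close> is determined by \<open>\<Lambda>\<close>. Statements holding
  \<open>\<eta>\<close>-almost everywhere thereby reach the projected measure.\<close>

lemma graph_base_marginal:
  assumes "graph_measure \<Omega> \<Lambda> \<eta> \<rho>"
  shows "base_marginal \<Omega> \<Lambda> = \<eta>"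
proof (rule measure_eqI)
  note g = graph_measureD[OF assms]
  show "sets (base_marginal \<Omega> \<Lambda>) = sets \<eta>" by (simp add: base_marginal_def g)
  fix A assume "A \<in> sets (base_marginal \<Omega> \<Lambda>)"
  then have [measurable]: "A \<in> sets (base_borel \<Omega>)" by (simp add: base_marginal_def)
  then have "A \<subseteq> \<Omega>" using sets.sets_into_space[of A "base_borel \<Omega>"] by simp
  have "emeasure (base_marginal \<Omega> \<Lambda>) A = emeasure \<Lambda> (base_on \<Omega> -` A \<inter> space \<Lambda>)"
    unfolding base_marginal_eq by (rule emeasure_distr) measurable
  also have "\<dots> = emeasure \<eta> {x \<in> \<Omega>. CPt x (\<rho> x) \<in> base_on \<Omega> -` A \<inter> space \<Lambda>}"
    by (rule graph_emeasure[OF assms]) measurable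
  also have "{x \<in> \<Omega>. CPt x (\<rho> x) \<in> base_on \<Omega> -` A \<inter> space \<Lambda>} = A"
    using \<open>A \<subseteq> \<Omega>\<close> assms by (auto simp: space_\<Lambda> graph_measure_def)
  finally show "emeasure (base_marginal \<Omega> \<Lambda>) A = emeasure \<eta> A" .
qed

lemma graph_finite:
  assumes "graph_measure \<Omega> \<Lambda> \<eta> \<rho>"
  shows "finite_measure \<eta>"
proof -
  have "finite_measure (distr \<Lambda> (base_borel \<Omega>) (base_on \<Omega>))"
    by (intro finite_measure.finite_measure_distr finite_\<Lambda>) measurable
  then show ?thesis using graph_base_marginal[OF assms] by (simp add: base_marginal_eq)
qed

text \<open>The disintegration is tested on the graph \<open>?S\<close>. It carries all the mass and
  its slice over \<open>x\<close> is the single point \<open>\<rho> x\<close>, so the integral of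
  \<open>emeasure (\<kappa> x) {\<rho> x}\<close> is the total mass of \<open>\<eta>\<close>. As the
  integrand is at most 1 and \<open>\<eta>\<close> is finite, it equals 1 almost everywhere.\<close>

lemma conditional_law_of_graph:
  assumes gr: "graph_measure \<Omega> \<Lambda> \<eta> \<rho>" and cond: "conditional_radial_law \<Omega> \<Lambda> \<kappa>"
  shows "AE x in \<eta>. \<kappa> x = return borel (\<rho> x)"
proof -
  note g = graph_measureD[OF gr]
  interpret finite_measure \<eta> using gr by (rule graph_finite)
  have \<rho>[measurable]: "\<rho> \<in> borel_measurable (base_borel \<Omega>)" and pos: "\<And>x. x \<in> \<Omega> \<Longrightarrow> 0 < \<rho> x"
    using gr by (auto simp: graph_measure_def)
  have \<kappa>: "\<kappa> \<in> base_borel \<Omega> \<rightarrow>\<^sub>M prob_algebra borel"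
    using cond by (simp add: conditional_radial_law_def)
  note sub[measurable] = measurable_prob_algebraD[OF \<kappa>]
  have prob: "sets (\<kappa> x) = sets borel" "prob_space (\<kappa> x)" if "x \<in> \<Omega>" for x
    using measurable_space[OF \<kappa>, of x] that by (auto simp: space_prob_algebra)
  \<comment> \<open>The apex is removed because \<open>conditional_radial_law\<close> speaks only of
    sets that avoid it.\<close>
  let ?S = "{p \<in> space \<Lambda>. cone_rad p = \<rho> (base_on \<Omega> p)} \<inter> (cone_over \<Omega> - {Apex})"
  have S: "?S \<in> sets \<Lambda>"
  proof (rule sets.Int)
    show "{p \<in> space \<Lambda>. cone_rad p = \<rho> (base_on \<Omega> p)} \<in> sets \<Lambda>" by measurable
    show "cone_over \<Omega> - {Apex} \<in> sets \<Lambda>" using cone_minus_Apex_sets[of \<Omega>] by (simp add: sets_\<Lambda>)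
  qed
  have "emeasure \<Lambda> ?S = (\<integral>\<^sup>+x. emeasure (\<kappa> x) {r. 0 < r \<and> CPt x r \<in> ?S} \<partial>\<eta>)"
    using conditional_radial_lawD[OF cond S] by (simp add: graph_base_marginal[OF gr])
  also have "\<dots> = (\<integral>\<^sup>+x. emeasure (\<kappa> x) {\<rho> x} \<partial>\<eta>)"
  proof (rule nn_integral_cong)
    fix x assume "x \<in> space \<eta>"
    then have "{r. 0 < r \<and> CPt x r \<in> ?S} = {\<rho> x}"
      using pos[of x] by (auto simp: g space_\<Lambda>)
    then show "emeasure (\<kappa> x) {r. 0 < r \<and> CPt x r \<in> ?S} = emeasure (\<kappa> x) {\<rho> x}" by simp
  qed
  finally have int: "(\<integral>\<^sup>+x. emeasure (\<kappa> x) {\<rho> x} \<partial>\<eta>) = emeasure \<Lambda> ?S" ..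
  have "emeasure \<Lambda> ?S = emeasure \<eta> {x \<in> \<Omega>. CPt x (\<rho> x) \<in> ?S}"
    using gr S by (rule graph_emeasure)
  also have "{x \<in> \<Omega>. CPt x (\<rho> x) \<in> ?S} = space \<eta>"
    using pos by (auto simp: g space_\<Lambda>)
  finally have total: "(\<integral>\<^sup>+x. emeasure (\<kappa> x) {\<rho> x} \<partial>\<eta>) = emeasure \<eta> (space \<eta>)"
    using int by simp
  have le: "emeasure (\<kappa> x) {\<rho> x} \<le> 1" if "x \<in> space \<eta>" for x
    using that prob[of x] prob_space.measure_le_1 by (auto simp: g)
  have graph_set: "(SIGMA x:space (base_borel \<Omega>). {\<rho> x}) \<in> sets (base_borel \<Omega> \<Otimes>\<^sub>M borel)"
  proof -
    have "(SIGMA x:space (base_borel \<Omega>). {\<rho> x}) = {z \<in> space (base_borel \<Omega> \<Otimes>\<^sub>M borel). snd z = \<rho> (fst z)}"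
      by (auto simp: space_pair_measure)
    also have "\<dots> \<in> sets (base_borel \<Omega> \<Otimes>\<^sub>M borel)" by measurable
    finally show ?thesis .
  qed
  have [measurable]: "(\<lambda>x. emeasure (\<kappa> x) {\<rho> x}) \<in> borel_measurable \<eta>"
    using emeasure_measurable_subprob_algebra2[OF graph_set sub] by (simp add: g cong: measurable_cong_sets)
  have "(\<integral>\<^sup>+x. 1 - emeasure (\<kappa> x) {\<rho> x} \<partial>\<eta>) = (\<integral>\<^sup>+x. 1 \<partial>\<eta>) - (\<integral>\<^sup>+x. emeasure (\<kappa> x) {\<rho> x} \<partial>\<eta>)"
    using le by (intro nn_integral_diff) (auto simp: total)
  also have "\<dots> = 0" by (simp add: total)
  finally have "AE x in \<eta>. 1 - emeasure (\<kappa> x) {\<rho> x} = 0"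
    by (subst (asm) nn_integral_0_iff_AE) auto
  then show ?thesis
    using AE_space
  proof eventually_elim
    case (elim x)
    \<comment> \<open>Subtraction in \<open>ennreal\<close> is truncated: a zero difference yields
      only \<open>1 \<le> emeasure (\<kappa> x) {\<rho> x}\<close>, and \<open>le\<close> gives the
      converse.\<close>
    then have "emeasure (\<kappa> x) {\<rho> x} = 1"
      using le[of x] by (metis antisym diff_eq_0_iff_ennreal ennreal_one_less_top order_less_imp_not_less top.not_eq_extremum)
    then show ?case
      using prob[of x] elim by (intro prob_space_eq_return) (auto simp: g)
  qed
qed

lemma conditional_law_return:
  assumes gr: "graph_measure \<Omega> \<Lambda> \<eta> \<rho>"
  shows "conditional_radial_law \<Omega> \<Lambda> (\<lambda>x. return borel (\<rho> x))"
  unfolding conditional_radial_law_def graph_base_marginal[OF gr]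
proof (intro conjI ballI impI)
  note g = graph_measureD[OF gr]
  have [measurable]: "\<rho> \<in> borel_measurable (base_borel \<Omega>)" and pos: "\<And>x. x \<in> \<Omega> \<Longrightarrow> 0 < \<rho> x"
    using gr by (auto simp: graph_measure_def)
  show "(\<lambda>x. return borel (\<rho> x)) \<in> base_borel \<Omega> \<rightarrow>\<^sub>M prob_algebra borel" by measurable
  fix B assume B: "B \<in> sets \<Lambda>"
  have "{x \<in> \<Omega>. CPt x (\<rho> x) \<in> B} = (\<lambda>x. CPt x (\<rho> x)) -` B \<inter> space \<eta>"
    using g(2) by auto
  then have meas: "{x \<in> \<Omega>. CPt x (\<rho> x) \<in> B} \<in> sets \<eta>"
    using measurable_sets[OF g(3)] B sets_\<Lambda> by metis
  have "emeasure \<Lambda> B = (\<integral>\<^sup>+x. indicator {x \<in> \<Omega>. CPt x (\<rho> x) \<in> B} x \<partial>\<eta>)"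
    using meas by (simp add: graph_emeasure[OF gr B])
  also have "\<dots> = (\<integral>\<^sup>+x. emeasure (return borel (\<rho> x)) {r. 0 < r \<and> CPt x r \<in> B} \<partial>\<eta>)"
  proof (rule nn_integral_cong)
    fix x assume "x \<in> space \<eta>"
    then show "indicator {x \<in> \<Omega>. CPt x (\<rho> x) \<in> B} x = emeasure (return borel (\<rho> x)) {r. 0 < r \<and> CPt x r \<in> B}"
      using radial_slice_measurable[of B \<Omega> x] B pos[of x] by (auto simp: g sets_\<Lambda> indicator_def)
  qed
  finally show "emeasure \<Lambda> B = (\<integral>\<^sup>+x. emeasure (return borel (\<rho> x)) {r. 0 < r \<and> CPt x r \<in> B} \<partial>\<eta>)" .
qed

text \<open>The base measure is forced to be the marginal. The real task is a measurable choice of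
  the atom, obtained by integration instead of pointwise selection.\<close>

lemma graph_of_deterministic:
  assumes cond: "conditional_radial_law \<Omega> \<Lambda> \<kappa>"
    and det: "AE x in base_marginal \<Omega> \<Lambda>. \<exists>s>0. \<kappa> x = return borel s"
  shows "\<exists>\<eta> \<rho>. graph_measure \<Omega> \<Lambda> \<eta> \<rho>"
proof -
  define \<eta> where "\<eta> = base_marginal \<Omega> \<Lambda>"
  have sets_\<eta>: "sets \<eta> = sets (base_borel \<Omega>)" by (simp add: \<eta>_def base_marginal_def)
  have space_\<eta>: "space \<eta> = \<Omega>" using sets_eq_imp_space_eq[OF sets_\<eta>] by simp
  have \<kappa>: "\<kappa> \<in> base_borel \<Omega> \<rightarrow>\<^sub>M prob_algebra borel"
    using cond by (simp add: conditional_radial_law_def)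
  note [measurable] = measurable_prob_algebraD[OF \<kappa>]
  \<comment> \<open>The mean of a Dirac mass is its atom, and means depend measurably on the kernel.
    The value 1 in \<open>\<rho>\<close> is a filler that makes it positive everywhere, as
    \<open>graph_measure\<close> demands.\<close>
  define m where "m x = enn2real (\<integral>\<^sup>+r. ennreal r \<partial>\<kappa> x)" for x
  define \<rho> where "\<rho> x = (if 0 < m x then m x else 1)" for x
  have "(\<lambda>x. \<integral>\<^sup>+r. ennreal r \<partial>\<kappa> x) \<in> borel_measurable (base_borel \<Omega>)"
    by (rule nn_integral_measurable_subprob_algebra2) measurable
  then have [measurable]: "m \<in> borel_measurable (base_borel \<Omega>)"
    unfolding m_def by measurable
  have \<rho>: "\<rho> \<in> borel_measurable (base_borel \<Omega>)" unfolding \<rho>_def by measurable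
  have pos: "\<forall>x\<in>\<Omega>. 0 < \<rho> x" by (simp add: \<rho>_def)
  have F: "(\<lambda>x. CPt x (\<rho> x)) \<in> \<eta> \<rightarrow>\<^sub>M cone_borel \<Omega>"
    using graph_map_measurable[OF \<rho> pos] by (simp add: sets_\<eta> cong: measurable_cong_sets)
  have ret: "AE x in \<eta>. \<kappa> x = return borel (\<rho> x)"
    using det unfolding \<eta>_def[symmetric]
  proof eventually_elim
    case (elim x)
    then obtain s where s: "0 < s" "\<kappa> x = return borel s" by blast
    then have "m x = s" by (simp add: m_def nn_integral_return)
    then show ?case using s by (simp add: \<rho>_def)
  qed
  have "\<Lambda> = distr \<eta> (cone_borel \<Omega>) (\<lambda>x. CPt x (\<rho> x))"
  proof (rule measure_eqI)
    show "sets \<Lambda> = sets (distr \<eta> (cone_borel \<Omega>) (\<lambda>x. CPt x (\<rho> x)))" by (simp add: sets_\<Lambda>)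
    fix B assume B: "B \<in> sets \<Lambda>"
    let ?B = "B \<inter> (cone_over \<Omega> - {Apex})"
    have B': "?B \<in> sets \<Lambda>" using B cone_minus_Apex_sets[of \<Omega>] sets_\<Lambda> by auto
    have "emeasure \<Lambda> B = emeasure \<Lambda> ?B"
    proof (rule emeasure_eq_AE[OF _ B B'])
      show "AE p in \<Lambda>. p \<in> B \<longleftrightarrow> p \<in> ?B"
        using AE_cone AE_space by eventually_elim (auto simp: space_\<Lambda>)
    qed
    also have "\<dots> = (\<integral>\<^sup>+x. emeasure (\<kappa> x) {r. 0 < r \<and> CPt x r \<in> ?B} \<partial>\<eta>)"
      using conditional_radial_lawD[OF cond B'] by (simp add: \<eta>_def)
    also have "\<dots> = (\<integral>\<^sup>+x. indicator ((\<lambda>x. CPt x (\<rho> x)) -` B \<inter> space \<eta>) x \<partial>\<eta>)"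
    proof (rule nn_integral_cong_AE)
      show "AE x in \<eta>. emeasure (\<kappa> x) {r. 0 < r \<and> CPt x r \<in> ?B} =
          indicator ((\<lambda>x. CPt x (\<rho> x)) -` B \<inter> space \<eta>) x"
        using ret AE_space
      proof eventually_elim
        case (elim x)
        then show ?case
          using radial_slice_measurable[of ?B \<Omega> x] B' pos
          by (auto simp: space_\<eta> sets_\<Lambda> indicator_def)
      qed
    qed
    also have "\<dots> = emeasure (distr \<eta> (cone_borel \<Omega>) (\<lambda>x. CPt x (\<rho> x))) B"
      using measurable_sets[OF F] B F by (simp add: emeasure_distr sets_\<Lambda>)
    finally show "emeasure \<Lambda> B = emeasure (distr \<eta> (cone_borel \<Omega>) (\<lambda>x. CPt x (\<rho> x))) B" .
  qed
  then show ?thesis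
    using sets_\<eta> \<rho> pos unfolding graph_measure_def by blast
qed

lemma deterministic_radial_law_iff_graph:
  "deterministic_radial_law \<Omega> \<Lambda> \<longleftrightarrow> (\<exists>\<eta> \<rho>. graph_measure \<Omega> \<Lambda> \<eta> \<rho>)"
proof
  assume "deterministic_radial_law \<Omega> \<Lambda>"
  then show "\<exists>\<eta> \<rho>. graph_measure \<Omega> \<Lambda> \<eta> \<rho>"
    using graph_of_deterministic unfolding deterministic_radial_law_def by blast
next
  assume "\<exists>\<eta> \<rho>. graph_measure \<Omega> \<Lambda> \<eta> \<rho>"
  then obtain \<eta> \<rho> where gr: "graph_measure \<Omega> \<Lambda> \<eta> \<rho>" by blast
  have "AE x in base_marginal \<Omega> \<Lambda>. \<exists>s>0. return borel (\<rho> x) = return borel s"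
  proof (rule AE_I2)
    fix x assume "x \<in> space (base_marginal \<Omega> \<Lambda>)"
    then have "0 < \<rho> x" using gr by (simp add: base_marginal_def graph_measure_def)
    then show "\<exists>s>0. return borel (\<rho> x) = return borel s" by blast
  qed
  then show "deterministic_radial_law \<Omega> \<Lambda>"
    using conditional_law_return[OF gr] unfolding deterministic_radial_law_def by blast
qed

section \<open>The projection as inverse of the lifting\<close>

lemma tangent_projection_graph:
  assumes gr: "graph_measure \<Omega> \<Lambda> \<eta> \<rho>" and cond: "conditional_radial_law \<Omega> \<Lambda> \<kappa>"
    and u: "u \<in> borel_measurable \<Lambda>"
  shows "AE x in \<eta>. tangent_projection \<kappa> u x =
    (fst (u (CPt x (\<rho> x))), snd (u (CPt x (\<rho> x))) / (2 * \<rho> x))"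
  using conditional_law_of_graph[OF gr cond] AE_space
proof eventually_elim
  case (elim x)
  then show ?case
    using gr u by (intro tangent_projection_return[of _ _ _ \<Omega>])
      (auto simp: graph_measureD[OF gr] graph_measure_def sets_\<Lambda> cong: measurable_cong_sets)
qed

lemma AE_graph_proj:
  assumes "graph_measure \<Omega> \<Lambda> \<eta> \<rho>" and "AE x in \<eta>. P x"
  shows "AE x in proj. P x"
  using assms(2) by (intro AE_base_marginal_proj) (simp only: graph_base_marginal[OF assms(1)])

text \<open>On the graph the lift has scalar component \<open>2 * snd (w x) * \<rho> x\<close>,
  which division by \<open>2 * \<rho> x\<close> undoes. Since \<open>u\<close> need be a lift only
  almost everywhere, this one fact yields the left inverse, membership in \<open>HK_tangent\<close>
  and linearity.\<close>

lemma tangent_projection_lift: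
  assumes gr: "graph_measure \<Omega> \<Lambda> \<eta> \<rho>" and cond: "conditional_radial_law \<Omega> \<Lambda> \<kappa>"
    and u: "u \<in> borel_measurable \<Lambda>" and eq: "AE p in \<Lambda>. u p = lift_field w p"
  shows "AE x in proj. tangent_projection \<kappa> u x = w x"
proof (rule AE_graph_proj[OF gr])
  show "AE x in \<eta>. tangent_projection \<kappa> u x = w x"
    using tangent_projection_graph[OF gr cond u] graph_AE[OF gr eq] AE_space
  proof eventually_elim
    case (elim x)
    then have "0 < \<rho> x" using gr graph_measureD(2)[OF gr] by (simp add: graph_measure_def)
    then show ?case using elim by (simp add: prod_eq_iff)
  qed
qed

lemma tangent_projection_in_HK_tangent:
  assumes gr: "graph_measure \<Omega> \<Lambda> \<eta> \<rho>" and cond: "conditional_radial_law \<Omega> \<Lambda> \<kappa>"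
    and u: "u \<in> borel_measurable \<Lambda>" and w: "w \<in> HK_tangent U proj"
    and eq: "AE p in \<Lambda>. u p = lift_field w p"
  shows "tangent_projection \<kappa> u \<in> HK_tangent U proj"
proof (rule HK_tangent_cong_AE[OF w _ _ sets_proj])
  have "tangent_projection \<kappa> u \<in> borel_measurable (base_borel \<Omega>)"
    using cond u by (intro tangent_projection_measurable)
      (auto simp: conditional_radial_law_def sets_\<Lambda> cong: measurable_cong_sets)
  then show "tangent_projection \<kappa> u \<in> borel_measurable proj"
    by (simp add: sets_proj cong: measurable_cong_sets)
  show "AE x in proj. tangent_projection \<kappa> u x = w x"
    using gr cond u eq by (rule tangent_projection_lift)
qed

text \<open>If \<open>u\<close> is a lift of \<open>w\<close>, its projection is \<open>w\<close>
  almost everywhere, and lifting respects such equalities.\<close>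

lemma lift_field_tangent_projection:
  assumes gr: "graph_measure \<Omega> \<Lambda> \<eta> \<rho>" and cond: "conditional_radial_law \<Omega> \<Lambda> \<kappa>"
    and u: "u \<in> lift_range U proj \<Lambda>"
  shows "AE p in \<Lambda>. lift_field (tangent_projection \<kappa> u) p = u p"
proof -
  obtain w where um: "u \<in> borel_measurable \<Lambda>" and eq: "AE p in \<Lambda>. u p = lift_field w p"
    using u by (auto simp: lift_range_def)
  show ?thesis
    using lift_field_AE_congD[OF tangent_projection_lift[OF gr cond um eq]] eq
    by eventually_elim simp
qed

lemma ae_isometry_tangent_projection:
  assumes gr: "graph_measure \<Omega> \<Lambda> \<eta> \<rho>" and cond: "conditional_radial_law \<Omega> \<Lambda> \<kappa>"
  shows "ae_isometry \<Lambda> (lift_range U proj \<Lambda>) (cone_inner \<Lambda>) proj (HK_tangent U proj) (HK_inner proj)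
    (tangent_projection \<kappa>)"
  unfolding ae_isometry_def
proof (intro conjI ballI allI)
  note proj_lift = tangent_projection_lift[OF gr cond]
  have in_T: "tangent_projection \<kappa> u \<in> HK_tangent U proj" if "u \<in> lift_range U proj \<Lambda>" for u
    using that tangent_projection_in_HK_tangent[OF gr cond] by (auto simp: lift_range_def)
  then show "tangent_projection \<kappa> u \<in> HK_tangent U proj" if "u \<in> lift_range U proj \<Lambda>" for u
    using that .
  note inv = lift_field_tangent_projection[OF gr cond]
  fix u u' c assume u: "u \<in> lift_range U proj \<Lambda>" "u' \<in> lift_range U proj \<Lambda>"
  note m = u[THEN in_T, THEN HK_tangent_measurable[OF _ sets_proj]]
  have um: "u \<in> borel_measurable \<Lambda>" "u' \<in> borel_measurable \<Lambda>"
    using u by (auto simp: lift_range_def)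
  have eq: "AE p in \<Lambda>. u p = lift_field (tangent_projection \<kappa> u) p"
      "AE p in \<Lambda>. u' p = lift_field (tangent_projection \<kappa> u') p"
    using u[THEN inv] by (auto simp: eq_commute)
  show "HK_inner proj (tangent_projection \<kappa> u) (tangent_projection \<kappa> u') = cone_inner \<Lambda> u u'"
    by (rule cone_inner_lift[OF m um eq, symmetric])
  have "(AE p in \<Lambda>. u p = u' p) \<longleftrightarrow>
      (AE p in \<Lambda>. lift_field (tangent_projection \<kappa> u) p = lift_field (tangent_projection \<kappa> u') p)"
    by (rule eventually_subst) (use eq in eventually_elim, simp)
  then show "(AE x in proj. tangent_projection \<kappa> u x = tangent_projection \<kappa> u' x) \<longleftrightarrow> (AE p in \<Lambda>. u p = u' p)"
    using lift_field_AE_eq_iff[OF m] by simp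
  \<comment> \<open>Linearity is inherited from the lift: the combination of the fields is a lift of
    the combination of their projections, and projecting a lift recovers what was lifted.\<close>
  show "AE x in proj. tangent_projection \<kappa> (\<lambda>p. u p + c *\<^sub>R u' p) x =
      tangent_projection \<kappa> u x + c *\<^sub>R tangent_projection \<kappa> u' x"
  proof (rule proj_lift)
    show "(\<lambda>p. u p + c *\<^sub>R u' p) \<in> borel_measurable \<Lambda>" using um by measurable
    show "AE p in \<Lambda>. u p + c *\<^sub>R u' p =
        lift_field (\<lambda>x. tangent_projection \<kappa> u x + c *\<^sub>R tangent_projection \<kappa> u' x) p"
      using eq
    proof eventually_elim
      case (elim p)
      then show ?case by (cases p) (auto simp: algebra_simps)
    qed
  qed
next
  fix w assume w: "w \<in> HK_tangent U proj"
  have "lift_field w \<in> lift_range U proj \<Lambda>" using w by (rule lift_field_in_lift_range)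
  moreover from this have "AE x in proj. tangent_projection \<kappa> (lift_field w) x = w x"
    by (intro tangent_projection_lift[OF gr cond]) (auto simp: lift_range_def)
  ultimately show "\<exists>u\<in>lift_range U proj \<Lambda>. AE x in proj. tangent_projection \<kappa> u x = w x" by blast
qed

end

text \<open>A conditional law is unique only up to null sets, hence the quantifier over all versions
  \<open>\<kappa>\<close>; by \<open>conditional_law_return\<close> every graph measure has
  one.\<close>

theorem theorem3p9:
  fixes \<Omega> U \<Gamma> :: "'a::euclidean_space set"
    and \<Lambda> :: "'a cone_point measure"
    and \<mu> :: "'a measure"
    and rmin rmax :: real
  assumes "compact \<Omega>" and "open U"
    and "compactly_inside \<Gamma> U" and "compactly_inside U (interior \<Omega>)"
    and "\<Lambda> \<in> cone_measures \<Omega>"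
    and "\<mu> = measure_projection \<Omega> \<Lambda>" and "\<mu> \<in> base_measures \<Omega> \<Gamma>"
    and "0 < rmin" and "rmin \<le> rmax" and "radially_supported \<Omega> rmin rmax \<Lambda>"
  shows "lift_range U \<mu> \<Lambda> \<subseteq> cone_tangent \<Omega> \<Lambda> \<and>
         ae_isometry \<mu> (HK_tangent U \<mu>) (HK_inner \<mu>)
           \<Lambda> (lift_range U \<mu> \<Lambda>) (cone_inner \<Lambda>) lift_field \<and>
         (deterministic_radial_law \<Omega> \<Lambda> \<longleftrightarrow> (\<exists>\<eta> \<rho>. graph_measure \<Omega> \<Lambda> \<eta> \<rho>)) \<and>
         (\<forall>\<eta> \<rho> \<kappa>. graph_measure \<Omega> \<Lambda> \<eta> \<rho> \<longrightarrow> conditional_radial_law \<Omega> \<Lambda> \<kappa> \<longrightarrow>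
           (\<forall>u\<in>cone_L2 \<Lambda>. AE x in \<mu>. tangent_projection \<kappa> u x =
              (fst (u (CPt x (\<rho> x))), snd (u (CPt x (\<rho> x))) / (2 * \<rho> x))) \<and>
           ae_isometry \<Lambda> (lift_range U \<mu> \<Lambda>) (cone_inner \<Lambda>)
             \<mu> (HK_tangent U \<mu>) (HK_inner \<mu>) (tangent_projection \<kappa>) \<and>
           (\<forall>w\<in>HK_tangent U \<mu>. AE x in \<mu>. tangent_projection \<kappa> (lift_field w) x = w x) \<and>
           (\<forall>u\<in>lift_range U \<mu> \<Lambda>. AE p in \<Lambda>. lift_field (tangent_projection \<kappa> u) p = u p))"
proof -
  interpret radial_cone_measure \<Omega> \<Lambda> rmin rmax
    using assms by unfold_locales
  have \<mu>: "\<mu> = proj" using assms(6) measure_projection_eq by simp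
  have U: "U \<subseteq> interior \<Omega>"
    using assms(4) closure_subset by (auto simp: compactly_inside_def)
  show ?thesis
    unfolding \<mu>
  proof (intro conjI allI impI ballI)
    show "lift_range U proj \<Lambda> \<subseteq> cone_tangent \<Omega> \<Lambda>" using U by (rule lift_range_subset_cone_tangent)
  next
    fix \<eta> \<rho> \<kappa> u assume gr: "graph_measure \<Omega> \<Lambda> \<eta> \<rho>" "conditional_radial_law \<Omega> \<Lambda> \<kappa>"
    assume "u \<in> cone_L2 \<Lambda>"
    then show "AE x in proj. tangent_projection \<kappa> u x =
        (fst (u (CPt x (\<rho> x))), snd (u (CPt x (\<rho> x))) / (2 * \<rho> x))"
      using tangent_projection_graph[OF gr] AE_graph_proj[OF gr(1)] by (simp add: cone_L2_def)
  next
    fix \<eta> \<rho> \<kappa> w assume gr: "graph_measure \<Omega> \<Lambda> \<eta> \<rho>" "conditional_radial_law \<Omega> \<Lambda> \<kappa>"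
    assume "w \<in> HK_tangent U proj"
    then have "lift_field w \<in> borel_measurable \<Lambda>"
      using lift_field_in_lift_range by (auto simp: lift_range_def)
    then show "AE x in proj. tangent_projection \<kappa> (lift_field w) x = w x"
      by (intro tangent_projection_lift[OF gr]) simp_all
  qed (rule ae_isometry_lift_field deterministic_radial_law_iff_graph ae_isometry_tangent_projection
      lift_field_tangent_projection; assumption)+
qed

end
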